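(* Write matrices in $\mathrm{SPD}(2)$ as $X=\begin{pmatrix} x & z \\ z & y \end{pmatrix}$ with $x>0,\ y>0,\ xy-z^2>0$. Let $\Phi(x,y,z)=\frac{x^4}{12}+\frac{y^4}{12}+\frac{z^2}{2}$, let $g=\mathrm{Hess}\,\Phi=x^2dx^2+y^2dy^2+dz^2$, let $\nabla^E$ be the flat connection with affine coordinates $(x,y,z)$, and let $(\nabla^E)^*$ be its $g$-dual, which is flat with affine coordinates $\eta=\left(\frac{x^3}{3},\frac{y^3}{3},z\right)$. Let $A,M,M_g$ be the midpoint means of $\nabla^E$, $(\nabla^E)^*$ and the Levi--Civita connection of $g$. Then $\eta(\mathrm{SPD}(2))$ is convex, so that $M(P,Q)=\eta^{-1}\left(\frac{\eta(P)+\eta(Q)}2\right)$ is defined for all $P,Q\in\mathrm{SPD}(2)$; the Gauss composition $(A\otimes M)(I_2,2I_2)$ exists, and $$(A\otimes M)(I_2,2I_2)\ne M_g(I_2,2I_2)=\sqrt{\tfrac52}\,I_2.$$ Moreover, for all $s,t>0$ with $s\ne t$, $$M_g\bigl(A(sI_2,tI_2),M(sI_2,tI_2)\bigr)\ne M_g(sI_2,tI_2).$$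
   Context: $\mathrm{SPD}(2)$ is the set of $2\times2$ real symmetric positive-definite matrices, regarded as an open subset of $\mathbb R^3$ through $(x,y,z)$. The $g$-dual $\nabla^*$ of a connection $\nabla$ is determined by $X[g(Y,Z)]=g(\nabla_XY,Z)+g(Y,\nabla^*_XZ)$. The midpoint mean of a connection $D$ is $M_D(P,Q)=\gamma(1/2)$, where $\gamma:[0,1]\to\mathrm{SPD}(2)$ is the unique affinely parametrized $D$-geodesic from $P$ to $Q$; for $\nabla^E$ it is $A(P,Q)=\frac{P+Q}{2}$. Gauss composition: put $(P_0,Q_0)=(P,Q)$ and $(P_{n+1},Q_{n+1})=(A(P_n,Q_n),M(P_n,Q_n))$; $(A\otimes M)(P,Q)$ is the common limit of $(P_n)$ and $(Q_n)$ if both converge to the same point. *)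

theory Defs
  imports "HOL-Analysis.Analysis"
begin

section \<open>Symmetric positive-definite matrices of size two\<close>

definition SPD2 :: "(real^2^2) set" where
  "SPD2 = {X. transpose X = X \<and> (\<forall>v. v \<noteq> 0 \<longrightarrow> v \<bullet> (X *v v) > 0)}"

text \<open>The coordinates \<open>(x, y, z)\<close> are the two diagonal entries and the off-diagonal entry,
  in this order.\<close>

definition coords :: "real^2^2 \<Rightarrow> real^3" where
  "coords X = vector [X $ 1 $ 1, X $ 2 $ 2, X $ 1 $ 2]"

definition sym_mat :: "real^3 \<Rightarrow> real^2^2" where
  "sym_mat p = vector [vector [p $ 1, p $ 3], vector [p $ 3, p $ 2]]"

definition SPD2_dom :: "(real^3) set" where
  "SPD2_dom = coords ` SPD2"

lemma SPD2_iff: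
  "X \<in> SPD2 \<longleftrightarrow> (\<exists>x y z. X = sym_mat (vector [x, y, z]) \<and> x > 0 \<and> y > 0 \<and> x * y - z\<^sup>2 > 0)"
proof
  assume X: "X \<in> SPD2"
  define x y z where "x = X $ 1 $ 1" "y = X $ 2 $ 2" "z = X $ 1 $ 2"
  have "transpose X $ 1 $ 2 = X $ 1 $ 2"
    using X by (simp add: SPD2_def)
  then have z: "X $ 2 $ 1 = z" by (simp add: transpose_def x_y_z_def)
  have pos: "a * (x * a + z * b) + b * (z * a + y * b) > 0" if "a \<noteq> 0 \<or> b \<noteq> 0" for a b
  proof -
    have "(vector [a, b] :: real^2) \<noteq> 0"
      using that by (auto simp: vec_eq_iff forall_2)
    with X have "(vector [a, b] :: real^2) \<bullet> (X *v vector [a, b]) > 0"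
      by (auto simp: SPD2_def)
    then show ?thesis
      using z by (simp add: inner_vec_def matrix_vector_mult_def sum_2 x_y_z_def)
  qed
  have xy: "x > 0" "y > 0" using pos[of 1 0] pos[of 0 1] by auto
  have "y * (x * y - z\<^sup>2) > 0"
    using pos[of y "- z"] xy by (simp add: power2_eq_square algebra_simps)
  then have "x * y - z\<^sup>2 > 0" using xy by (simp add: zero_less_mult_iff)
  moreover have "X = sym_mat (vector [x, y, z])"
    using z by (simp add: sym_mat_def vec_eq_iff forall_2 x_y_z_def)
  ultimately show "\<exists>x y z. X = sym_mat (vector [x, y, z]) \<and> x > 0 \<and> y > 0 \<and> x * y - z\<^sup>2 > 0"
    using xy by blast
next
  assume "\<exists>x y z. X = sym_mat (vector [x, y, z]) \<and> x > 0 \<and> y > 0 \<and> x * y - z\<^sup>2 > 0"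
  then obtain x y z where X: "X = sym_mat (vector [x, y, z])"
    and pos: "x > 0" "y > 0" "x * y - z\<^sup>2 > 0" by blast
  have "v \<bullet> (X *v v) > 0" if "v \<noteq> 0" for v
  proof -
    let ?a = "v $ 1" and ?b = "v $ 2"
    have ab: "?a \<noteq> 0 \<or> ?b \<noteq> 0" using that by (auto simp: vec_eq_iff forall_2)
    have "(x * ?a + z * ?b)\<^sup>2 + (x * y - z\<^sup>2) * ?b\<^sup>2 > 0"
    proof (cases "?b = 0")
      case True
      then show ?thesis using ab pos by simp
    next
      case False
      then have "(x * y - z\<^sup>2) * ?b\<^sup>2 > 0" using pos by simp
      then show ?thesis by (simp add: add_nonneg_pos)
    qed
    also have "(x * ?a + z * ?b)\<^sup>2 + (x * y - z\<^sup>2) * ?b\<^sup>2 = x * (v \<bullet> (X *v v))"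
      by (simp add: X sym_mat_def inner_vec_def matrix_vector_mult_def sum_2
          power2_eq_square algebra_simps)
    finally show ?thesis using pos by (simp add: zero_less_mult_iff)
  qed
  moreover have "transpose X = X"
    by (simp add: X sym_mat_def transpose_def vec_eq_iff forall_2)
  ultimately show "X \<in> SPD2" by (simp add: SPD2_def)
qed

section \<open>Smooth maps and affine connections on an open subset of three-space\<close>

text \<open>The definitions below are meant for open sets \<open>U\<close>. Maps and vector fields are total
  functions of which only the values on \<open>U\<close> matter.\<close>

primrec Ck_on :: "nat \<Rightarrow> 'a::real_normed_vector set \<Rightarrow> ('a \<Rightarrow> 'b::real_normed_vector) \<Rightarrow> bool" where
  "Ck_on 0 U f \<longleftrightarrow> continuous_on U f"
| "Ck_on (Suc k) U f \<longleftrightarrow>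
     (\<forall>p\<in>U. f differentiable (at p)) \<and> (\<forall>v. Ck_on k U (\<lambda>p. frechet_derivative f (at p) v))"

definition smooth_on :: "'a::real_normed_vector set \<Rightarrow> ('a \<Rightarrow> 'b::real_normed_vector) \<Rightarrow> bool" where
  "smooth_on U f \<longleftrightarrow> (\<forall>k. Ck_on k U f)"

type_synonym vfield = "real^3 \<Rightarrow> real^3"
type_synonym conn = "vfield \<Rightarrow> vfield \<Rightarrow> vfield"
type_synonym metric = "real^3 \<Rightarrow> real^3 \<Rightarrow> real^3 \<Rightarrow> real"

text \<open>The derivative of \<open>f\<close> along the vector field \<open>X\<close>.\<close>

definition dir_deriv :: "vfield \<Rightarrow> (real^3 \<Rightarrow> 'b::real_normed_vector) \<Rightarrow> real^3 \<Rightarrow> 'b" where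
  "dir_deriv X f p = frechet_derivative f (at p) (X p)"

definition lie_bracket :: "vfield \<Rightarrow> vfield \<Rightarrow> vfield" where
  "lie_bracket X Y p = dir_deriv X Y p - dir_deriv Y X p"

definition affine_connection :: "(real^3) set \<Rightarrow> conn \<Rightarrow> bool" where
  "affine_connection U D \<longleftrightarrow>
     (\<forall>X Y. smooth_on U X \<longrightarrow> smooth_on U Y \<longrightarrow> smooth_on U (D X Y)) \<and>
     (\<forall>X X' Y. smooth_on U X \<longrightarrow> smooth_on U X' \<longrightarrow> smooth_on U Y \<longrightarrow>
        (\<forall>p\<in>U. D (\<lambda>q. X q + X' q) Y p = D X Y p + D X' Y p)) \<and>
     (\<forall>f X Y. smooth_on U f \<longrightarrow> smooth_on U X \<longrightarrow> smooth_on U Y \<longrightarrow>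
        (\<forall>p\<in>U. D (\<lambda>q. f q *\<^sub>R X q) Y p = f p *\<^sub>R D X Y p)) \<and>
     (\<forall>X Y Y'. smooth_on U X \<longrightarrow> smooth_on U Y \<longrightarrow> smooth_on U Y' \<longrightarrow>
        (\<forall>p\<in>U. D X (\<lambda>q. Y q + Y' q) p = D X Y p + D X Y' p)) \<and>
     (\<forall>f X Y. smooth_on U f \<longrightarrow> smooth_on U X \<longrightarrow> smooth_on U Y \<longrightarrow>
        (\<forall>p\<in>U. D X (\<lambda>q. f q *\<^sub>R Y q) p = f p *\<^sub>R D X Y p + dir_deriv X f p *\<^sub>R Y p))"

definition coordinate_system :: "(real^3) set \<Rightarrow> (real^3 \<Rightarrow> real^3) \<Rightarrow> bool" where
  "coordinate_system U \<phi> \<longleftrightarrow>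
     smooth_on U \<phi> \<and> inj_on \<phi> U \<and> (\<forall>p\<in>U. bij (frechet_derivative \<phi> (at p)))"

text \<open>The coordinate vector field \<open>\<partial>/\<partial>\<phi>\<^sub>i\<close>.\<close>

definition coord_vfield :: "(real^3 \<Rightarrow> real^3) \<Rightarrow> 3 \<Rightarrow> vfield" where
  "coord_vfield \<phi> i p = inv (frechet_derivative \<phi> (at p)) (axis i 1)"

text \<open>All Christoffel symbols of \<open>D\<close> in the coordinates \<open>\<phi>\<close> vanish, i.e. the coordinate vector
  fields form a global parallel frame. In particular \<open>D\<close> has neither curvature nor torsion.\<close>

definition flat_with_affine_coordinates :: "(real^3) set \<Rightarrow> conn \<Rightarrow> (real^3 \<Rightarrow> real^3) \<Rightarrow> bool" where
  "flat_with_affine_coordinates U D \<phi> \<longleftrightarrow>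
     affine_connection U D \<and> coordinate_system U \<phi> \<and>
     (\<forall>i j. \<forall>p\<in>U. D (coord_vfield \<phi> i) (coord_vfield \<phi> j) p = 0)"

definition dual_connection :: "(real^3) set \<Rightarrow> metric \<Rightarrow> conn \<Rightarrow> conn \<Rightarrow> bool" where
  "dual_connection U g D D' \<longleftrightarrow>
     affine_connection U D' \<and>
     (\<forall>X Y Z. smooth_on U X \<longrightarrow> smooth_on U Y \<longrightarrow> smooth_on U Z \<longrightarrow>
        (\<forall>p\<in>U. dir_deriv X (\<lambda>q. g q (Y q) (Z q)) p = g p (D X Y p) (Z p) + g p (Y p) (D' X Z p)))"

text \<open>Compatibility with the metric says that the connection is its own dual.\<close>

definition levi_civita :: "(real^3) set \<Rightarrow> metric \<Rightarrow> conn \<Rightarrow> bool" where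
  "levi_civita U g D \<longleftrightarrow>
     dual_connection U g D D \<and>
     (\<forall>X Y. smooth_on U X \<longrightarrow> smooth_on U Y \<longrightarrow>
        (\<forall>p\<in>U. D X Y p - D Y X p = lie_bracket X Y p))"

text \<open>The Hessian of a function with respect to the coordinates \<open>(x, y, z)\<close>.\<close>

definition Hess :: "(real^3 \<Rightarrow> real) \<Rightarrow> metric" where
  "Hess F p u v = frechet_derivative (\<lambda>q. frechet_derivative F (at q) v) (at p) u"

section \<open>Geodesics and means\<close>

text \<open>In the coordinates \<open>(x, y, z)\<close> the geodesic equation for a curve \<open>c\<close> is
  \<open>c'' + \<Gamma>(c', c') = 0\<close>, where the Christoffel term \<open>\<Gamma>(v, w)\<close> at a point is the
  covariant derivative there of the constant field \<open>w\<close> along the constant field \<open>v\<close>.\<close>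

definition geodesic :: "conn \<Rightarrow> real^2^2 \<Rightarrow> real^2^2 \<Rightarrow> (real \<Rightarrow> real^2^2) \<Rightarrow> bool" where
  "geodesic D P Q \<gamma> \<longleftrightarrow>
     \<gamma> 0 = P \<and> \<gamma> 1 = Q \<and> (\<forall>t\<in>{0..1}. \<gamma> t \<in> SPD2) \<and>
     (\<exists>c' c''. \<forall>t\<in>{0..1}.
        ((\<lambda>r. coords (\<gamma> r)) has_vector_derivative c' t) (at t within {0..1}) \<and>
        (c' has_vector_derivative c'' t) (at t within {0..1}) \<and>
        c'' t + D (\<lambda>_. c' t) (\<lambda>_. c' t) (coords (\<gamma> t)) = 0)"

definition is_midpoint :: "conn \<Rightarrow> real^2^2 \<Rightarrow> real^2^2 \<Rightarrow> real^2^2 \<Rightarrow> bool" where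
  "is_midpoint D P Q R \<longleftrightarrow>
     (\<exists>\<gamma>. geodesic D P Q \<gamma> \<and>
        (\<forall>\<delta>. geodesic D P Q \<delta> \<longrightarrow> (\<forall>t\<in>{0..1}. \<delta> t = \<gamma> t)) \<and> R = \<gamma> (1/2))"

definition midpoint_mean_defined :: "conn \<Rightarrow> real^2^2 \<Rightarrow> real^2^2 \<Rightarrow> bool" where
  "midpoint_mean_defined D P Q \<longleftrightarrow> (\<exists>R. is_midpoint D P Q R)"

definition midpoint_mean :: "conn \<Rightarrow> real^2^2 \<Rightarrow> real^2^2 \<Rightarrow> real^2^2" where
  "midpoint_mean D P Q = (THE R. is_midpoint D P Q R)"

primrec gauss_seq :: "('a \<Rightarrow> 'a \<Rightarrow> 'a) \<Rightarrow> ('a \<Rightarrow> 'a \<Rightarrow> 'a) \<Rightarrow> 'a \<Rightarrow> 'a \<Rightarrow> nat \<Rightarrow> 'a \<times> 'a" where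
  "gauss_seq A M P Q 0 = (P, Q)"
| "gauss_seq A M P Q (Suc n) =
     (let (Pn, Qn) = gauss_seq A M P Q n in (A Pn Qn, M Pn Qn))"

definition is_gauss_limit ::
  "(real^2^2 \<Rightarrow> real^2^2 \<Rightarrow> real^2^2) \<Rightarrow> (real^2^2 \<Rightarrow> real^2^2 \<Rightarrow> real^2^2)
     \<Rightarrow> real^2^2 \<Rightarrow> real^2^2 \<Rightarrow> real^2^2 \<Rightarrow> bool" where
  "is_gauss_limit A M P Q L \<longleftrightarrow>
     L \<in> SPD2 \<and>
     (\<lambda>n. fst (gauss_seq A M P Q n)) \<longlonglongrightarrow> L \<and>
     (\<lambda>n. snd (gauss_seq A M P Q n)) \<longlonglongrightarrow> L"

definition gauss_comp_exists ::
  "(real^2^2 \<Rightarrow> real^2^2 \<Rightarrow> real^2^2) \<Rightarrow> (real^2^2 \<Rightarrow> real^2^2 \<Rightarrow> real^2^2)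
     \<Rightarrow> real^2^2 \<Rightarrow> real^2^2 \<Rightarrow> bool" where
  "gauss_comp_exists A M P Q \<longleftrightarrow> (\<exists>L. is_gauss_limit A M P Q L)"

definition gauss_comp ::
  "(real^2^2 \<Rightarrow> real^2^2 \<Rightarrow> real^2^2) \<Rightarrow> (real^2^2 \<Rightarrow> real^2^2 \<Rightarrow> real^2^2)
     \<Rightarrow> real^2^2 \<Rightarrow> real^2^2 \<Rightarrow> real^2^2" where
  "gauss_comp A M P Q = (THE L. is_gauss_limit A M P Q L)"

section \<open>The potential, its metric, and the three connections\<close>

definition Phi :: "real^3 \<Rightarrow> real" where
  "Phi p = (p $ 1) ^ 4 / 12 + (p $ 2) ^ 4 / 12 + (p $ 3)\<^sup>2 / 2"

definition eta :: "real^3 \<Rightarrow> real^3" where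
  "eta p = vector [(p $ 1) ^ 3 / 3, (p $ 2) ^ 3 / 3, p $ 3]"

definition Phi_connections :: "conn \<Rightarrow> conn \<Rightarrow> conn \<Rightarrow> bool" where
  "Phi_connections DE DE' DLC \<longleftrightarrow>
     flat_with_affine_coordinates SPD2_dom DE (\<lambda>p. p) \<and>
     dual_connection SPD2_dom (Hess Phi) DE DE' \<and>
     levi_civita SPD2_dom (Hess Phi) DLC"

abbreviation scalar_mat :: "real \<Rightarrow> real^2^2" where
  "scalar_mat s \<equiv> s *\<^sub>R mat 1"

end

theory Submission
  imports Defs
begin

text \<open>
  The metric, the three connections and the domain are handled together. Write
  \<open>power_connection c\<close> for the connection with Christoffel symbols \<open>c/x\<close> and \<open>c/y\<close> in the
  first two coordinates. Because the metric coefficients are \<open>x\<^sup>2\<close> and \<open>y\<^sup>2\<close>, the members \<open>a\<close>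
  and \<open>b\<close> of this family are dual to each other as soon as \<open>a + b = 2\<close>
  (\<open>dual_power_connection\<close>). So \<open>c = 0\<close> is the flat connection, \<open>c = 2\<close> is its dual and
  \<open>c = 1\<close>, being self-dual and torsion-free, is the Levi-Civita connection. Conversely, the
  three defining properties determine the connections on smooth fields
  (\<open>Phi_connections_unique\<close>).

  The geodesic equation of \<open>power_connection c\<close> says that \<open>(x ^ k, y ^ k, z)\<close> with \<open>k = c + 1\<close>
  moves along a straight line. The domain is convex in these coordinates: its image is described
  by \<open>\<bar>z\<bar> ^ k < sqrt (u v)\<close>, with a convex left-hand side and a concave right-hand side
  (\<open>convex_power_chart_image\<close>). Hence any two points are joined by exactly one geodesic, and the
  midpoint means are the power means of exponents 1, 3 and 2 in the diagonal entries, together with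
  the arithmetic mean in \<open>z\<close> (\<open>midpoint_mean_power\<close>).

  On scalar matrices everything reduces to real numbers. If \<open>a\<close> and \<open>m\<close> are the arithmetic and
  cubic means of \<open>s \<noteq> t\<close>, then \<open>a\<^sup>2 + m\<^sup>2 < s\<^sup>2 + t\<^sup>2\<close> (\<open>mean_squares_less\<close>). Since the quadratic
  mean depends exactly on the sum of squares, it is not invariant under \<open>(s, t) \<mapsto> (a, m)\<close>.
  Along the Gauss iteration from \<open>(1, 2)\<close> the sum of squares decreases, so the common limit \<open>L\<close>
  satisfies \<open>2 L\<^sup>2 < 5\<close> and differs from \<open>sqrt (5/2)\<close>.
\<close>

section \<open>Smooth functions\<close>

lemma Ck_on_cong:
  assumes "open U" "\<And>p. p \<in> U \<Longrightarrow> f p = g p"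
  shows "Ck_on k U f \<longleftrightarrow> Ck_on k U g"
  using assms(2)
proof (induction k arbitrary: f g)
  case 0
  then show ?case by (simp cong: continuous_on_cong)
next
  case (Suc k)
  have der: "(f has_derivative D) (at p) \<longleftrightarrow> (g has_derivative D) (at p)" if "p \<in> U" for p D
    using has_derivative_transform_within_open[OF _ \<open>open U\<close> that, of f D UNIV g]
      has_derivative_transform_within_open[OF _ \<open>open U\<close> that, of g D UNIV f] Suc.prems
    by metis
  have "Ck_on k U (\<lambda>p. frechet_derivative f (at p) v)
      \<longleftrightarrow> Ck_on k U (\<lambda>p. frechet_derivative g (at p) v)" for v
    by (rule Suc.IH) (simp add: frechet_derivative_def der)
  then show ?case by (simp add: differentiable_def der)
qed

text \<open>A derivative known only on the open set suffices, whatever \<open>frechet_derivative\<close> returns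
  elsewhere.\<close>

lemma Ck_on_Suc_intro:
  assumes "open U" "\<And>p. p \<in> U \<Longrightarrow> (f has_derivative D p) (at p)"
    and "\<And>v. Ck_on k U (\<lambda>p. D p v)"
  shows "Ck_on (Suc k) U f"
proof -
  have "frechet_derivative f (at p) = D p" if "p \<in> U" for p
    using frechet_derivative_at[OF assms(2)[OF that]] by simp
  then have "Ck_on k U (\<lambda>p. frechet_derivative f (at p) v)" for v
    using Ck_on_cong[OF assms(1), of "\<lambda>p. frechet_derivative f (at p) v" "\<lambda>p. D p v" k]
      assms(3) by simp
  then show ?thesis using assms(2) by (auto simp: differentiable_def)
qed

lemma Ck_on_has_derivative:
  "Ck_on (Suc k) U f \<Longrightarrow> p \<in> U \<Longrightarrow> (f has_derivative frechet_derivative f (at p)) (at p)"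
  by (simp add: frechet_derivative_works)

lemma Ck_on_Suc_D: "Ck_on (Suc k) U f \<Longrightarrow> Ck_on k U f"
proof (induction k arbitrary: f)
  case 0
  then show ?case
    by (auto intro!: differentiable_imp_continuous_on
        simp: differentiable_on_def differentiable_at_withinI)
next
  case (Suc k)
  then have "Ck_on k U (\<lambda>p. frechet_derivative f (at p) v)" for v by simp
  then show ?case using Suc.prems by simp
qed

lemma Ck_on_const: "Ck_on k U (\<lambda>_. c)"
  by (induction k arbitrary: c) (simp_all add: frechet_derivative_const)

lemma Ck_on_bounded_linear:
  assumes "open U" "bounded_linear L" "Ck_on k U f"
  shows "Ck_on k U (\<lambda>p. L (f p))"
  using assms(3)
proof (induction k arbitrary: f)
  case 0
  then show ?case by (simp add: bounded_linear.continuous_on[OF assms(2)])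
next
  case (Suc k)
  then have "\<And>p. p \<in> U \<Longrightarrow> (f has_derivative frechet_derivative f (at p)) (at p)"
    by (simp add: frechet_derivative_works)
  then have "((\<lambda>p. L (f p)) has_derivative (\<lambda>v. L (frechet_derivative f (at p) v))) (at p)"
    if "p \<in> U" for p
    using bounded_linear.has_derivative[OF assms(2)] that by blast
  then show ?case by (rule Ck_on_Suc_intro[OF assms(1)]) (use Suc in simp_all)
qed

lemma Ck_on_add:
  assumes "open U" "Ck_on k U f" "Ck_on k U g"
  shows "Ck_on k U (\<lambda>p. f p + g p)"
  using assms(2,3)
proof (induction k arbitrary: f g)
  case 0
  then show ?case by (simp add: continuous_on_add)
next
  case (Suc k)
  show ?case
  proof (rule Ck_on_Suc_intro[OF assms(1)])
    show "((\<lambda>p. f p + g p) has_derivative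
        (\<lambda>v. frechet_derivative f (at p) v + frechet_derivative g (at p) v)) (at p)"
      if "p \<in> U" for p
      using Suc.prems[THEN Ck_on_has_derivative, OF that] by (rule has_derivative_add)
    show "Ck_on k U (\<lambda>p. frechet_derivative f (at p) v + frechet_derivative g (at p) v)" for v
      using Suc by simp
  qed
qed

lemma Ck_on_bounded_bilinear:
  assumes "open U" "bounded_bilinear B" "Ck_on k U f" "Ck_on k U g"
  shows "Ck_on k U (\<lambda>p. B (f p) (g p))"
  using assms(3,4)
proof (induction k arbitrary: f g)
  case 0
  then show ?case by (simp add: bounded_bilinear.continuous_on[OF assms(2)])
next
  case (Suc k)
  show ?case
  proof (rule Ck_on_Suc_intro[OF assms(1)])
    show "((\<lambda>p. B (f p) (g p)) has_derivative
        (\<lambda>v. B (f p) (frechet_derivative g (at p) v) + B (frechet_derivative f (at p) v) (g p))) (at p)"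
      if "p \<in> U" for p
      using Suc.prems[THEN Ck_on_has_derivative, OF that]
      by (rule bounded_bilinear.FDERIV[OF assms(2)])
    show "Ck_on k U (\<lambda>p. B (f p) (frechet_derivative g (at p) v)
        + B (frechet_derivative f (at p) v) (g p))" for v
      by (intro Ck_on_add[OF assms(1)] Suc.IH Ck_on_Suc_D[OF Suc.prems(1)]
          Ck_on_Suc_D[OF Suc.prems(2)]) (use Suc.prems in simp_all)
  qed
qed

text \<open>The derivative of \<open>1/f\<close> contains \<open>1/f\<close> again, but only to the order already reached, so
  the product rule closes the induction.\<close>

lemma Ck_on_inverse:
  fixes f :: "'a::real_normed_vector \<Rightarrow> real"
  assumes "open U" "\<And>p. p \<in> U \<Longrightarrow> f p \<noteq> 0" "Ck_on k U f"
  shows "Ck_on k U (\<lambda>p. inverse (f p))"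
  using assms(3)
proof (induction k)
  case 0
  then show ?case using assms(2) by (simp add: continuous_on_inverse)
next
  case (Suc k)
  show ?case
  proof (rule Ck_on_Suc_intro[OF assms(1)])
    show "((\<lambda>p. inverse (f p)) has_derivative
        (\<lambda>v. - (inverse (f p) * frechet_derivative f (at p) v * inverse (f p)))) (at p)"
      if "p \<in> U" for p
      using assms(2)[OF that] Ck_on_has_derivative[OF Suc.prems that]
      by (rule Deriv.has_derivative_inverse)
    have inv: "Ck_on k U (\<lambda>p. inverse (f p))"
      using Suc.IH Suc.prems Ck_on_Suc_D by blast
    show "Ck_on k U (\<lambda>p. - (inverse (f p) * frechet_derivative f (at p) v * inverse (f p)))" for v
      by (intro Ck_on_bounded_linear[OF assms(1) bounded_linear_minus[OF bounded_linear_ident]]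
          Ck_on_bounded_bilinear[OF assms(1) bounded_bilinear_mult] inv) (use Suc.prems in simp)
  qed
qed

lemma smooth_on_cong:
  "open U \<Longrightarrow> (\<And>p. p \<in> U \<Longrightarrow> f p = g p) \<Longrightarrow> smooth_on U f \<longleftrightarrow> smooth_on U g"
  unfolding smooth_on_def using Ck_on_cong by metis

lemma smooth_on_const: "smooth_on U (\<lambda>_. c)"
  by (simp add: smooth_on_def Ck_on_const)

lemma smooth_on_ident: "smooth_on U (\<lambda>p. p)"
  unfolding smooth_on_def
proof
  show "Ck_on k U (\<lambda>p. p)" for k
    by (cases k) (simp_all add: Ck_on_const)
qed

lemma smooth_on_bounded_linear:
  "open U \<Longrightarrow> bounded_linear L \<Longrightarrow> smooth_on U f \<Longrightarrow> smooth_on U (\<lambda>p. L (f p))"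
  by (simp add: smooth_on_def Ck_on_bounded_linear)

lemma smooth_on_add:
  "open U \<Longrightarrow> smooth_on U f \<Longrightarrow> smooth_on U g \<Longrightarrow> smooth_on U (\<lambda>p. f p + g p)"
  by (simp add: smooth_on_def Ck_on_add)

lemma smooth_on_scaleR:
  "open U \<Longrightarrow> smooth_on U f \<Longrightarrow> smooth_on U g \<Longrightarrow> smooth_on U (\<lambda>p. f p *\<^sub>R g p)"
  by (simp add: smooth_on_def Ck_on_bounded_bilinear bounded_bilinear_scaleR)

lemma smooth_on_mult:
  fixes f g :: "'a::real_normed_vector \<Rightarrow> real"
  shows "open U \<Longrightarrow> smooth_on U f \<Longrightarrow> smooth_on U g \<Longrightarrow> smooth_on U (\<lambda>p. f p * g p)"
  using smooth_on_scaleR[of U f g] by simp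

lemma smooth_on_power:
  fixes f :: "'a::real_normed_vector \<Rightarrow> real"
  shows "open U \<Longrightarrow> smooth_on U f \<Longrightarrow> smooth_on U (\<lambda>p. f p ^ n)"
  by (induction n) (simp_all add: smooth_on_const smooth_on_mult)

lemma smooth_on_divide:
  fixes f g :: "'a::real_normed_vector \<Rightarrow> real"
  assumes "open U" "\<And>p. p \<in> U \<Longrightarrow> g p \<noteq> 0" "smooth_on U f" "smooth_on U g"
  shows "smooth_on U (\<lambda>p. f p / g p)"
  unfolding divide_inverse
  using assms by (intro smooth_on_mult) (simp_all add: smooth_on_def Ck_on_inverse)

lemma smooth_on_nth: "open U \<Longrightarrow> smooth_on U f \<Longrightarrow> smooth_on U (\<lambda>p. f p $ i)"
  by (rule smooth_on_bounded_linear[OF _ bounded_linear_vec_nth])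

lemma smooth_on_frechet_derivative:
  "smooth_on U f \<Longrightarrow> smooth_on U (\<lambda>p. frechet_derivative f (at p) v)"
  by (metis Ck_on.simps(2) smooth_on_def)

lemma smooth_on_has_derivative:
  "smooth_on U f \<Longrightarrow> p \<in> U \<Longrightarrow> (f has_derivative frechet_derivative f (at p)) (at p)"
  by (metis Ck_on.simps(2) smooth_on_def frechet_derivative_works)

section \<open>Vectors in three coordinates\<close>

lemma vec3_expand:
  fixes v :: "real^3"
  shows "v = v $ 1 *\<^sub>R axis 1 1 + (v $ 2 *\<^sub>R axis 2 1 + v $ 3 *\<^sub>R axis 3 1)"
  by (simp add: vec_eq_iff forall_3 axis_def)

lemma vector3_expand:
  "(vector [x, y, z] :: real^3) = x *\<^sub>R axis 1 1 + (y *\<^sub>R axis 2 1 + z *\<^sub>R axis 3 1)"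
  by (simp add: vec_eq_iff forall_3 axis_def)

lemma smooth_on_vector3:
  fixes f g h :: "'a::real_normed_vector \<Rightarrow> real"
  assumes "open U" "smooth_on U f" "smooth_on U g" "smooth_on U h"
  shows "smooth_on U (\<lambda>p. vector [f p, g p, h p] :: real^3)"
  unfolding vector3_expand
  by (intro smooth_on_add smooth_on_scaleR smooth_on_const assms)

lemma has_derivative_vector3:
  fixes f g h :: "'a::real_normed_vector \<Rightarrow> real"
  assumes "(f has_derivative f') F" "(g has_derivative g') F" "(h has_derivative h') F"
  shows "((\<lambda>p. vector [f p, g p, h p] :: real^3) has_derivative
    (\<lambda>v. vector [f' v, g' v, h' v])) F"
  unfolding vector3_expand
  by (intro has_derivative_add has_derivative_scaleR_left assms)

text \<open>Expanding \<open>X\<close> in the standard basis leaves the derivatives of \<open>f\<close> along constant vectors,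
  which are the ones that the definition of smoothness controls.\<close>

lemma smooth_on_dir_deriv:
  fixes X :: vfield and f :: "real^3 \<Rightarrow> 'b::real_normed_vector"
  assumes "open U" "smooth_on U X" "smooth_on U f"
  shows "smooth_on U (dir_deriv X f)"
proof -
  let ?d = "\<lambda>p i. frechet_derivative f (at p) (axis i 1)"
  have "dir_deriv X f p = X p $ 1 *\<^sub>R ?d p 1 + (X p $ 2 *\<^sub>R ?d p 2 + X p $ 3 *\<^sub>R ?d p 3)"
    if "p \<in> U" for p
  proof -
    have lin: "linear (frechet_derivative f (at p))"
      using smooth_on_has_derivative[OF assms(3) that] has_derivative_linear by blast
    show ?thesis
      unfolding dir_deriv_def
      by (subst vec3_expand) (simp only: linear_add[OF lin] linear_scale[OF lin])
  qed
  then have "smooth_on U (dir_deriv X f) \<longleftrightarrow>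
      smooth_on U (\<lambda>p. X p $ 1 *\<^sub>R ?d p 1 + (X p $ 2 *\<^sub>R ?d p 2 + X p $ 3 *\<^sub>R ?d p 3))"
    by (rule smooth_on_cong[OF assms(1)])
  moreover have "smooth_on U (\<lambda>p. X p $ 1 *\<^sub>R ?d p 1 + (X p $ 2 *\<^sub>R ?d p 2 + X p $ 3 *\<^sub>R ?d p 3))"
    using assms
    by (intro smooth_on_add smooth_on_scaleR smooth_on_nth smooth_on_frechet_derivative)
  ultimately show ?thesis by simp
qed

section \<open>The coordinate domain\<close>

lemma coords_sym_mat [simp]: "coords (sym_mat p) = p"
  by (simp add: coords_def sym_mat_def vec_eq_iff forall_3)

lemma sym_mat_in_SPD2_iff:
  "sym_mat p \<in> SPD2 \<longleftrightarrow> p $ 1 > 0 \<and> p $ 2 > 0 \<and> (p $ 3)\<^sup>2 < p $ 1 * p $ 2"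
proof
  assume "sym_mat p \<in> SPD2"
  then obtain x y z where "sym_mat p = sym_mat (vector [x, y, z])"
    and pos: "x > 0" "y > 0" "x * y - z\<^sup>2 > 0"
    unfolding SPD2_iff by blast
  then have "p = vector [x, y, z]" by (metis coords_sym_mat)
  then show "p $ 1 > 0 \<and> p $ 2 > 0 \<and> (p $ 3)\<^sup>2 < p $ 1 * p $ 2" using pos by simp
next
  assume "p $ 1 > 0 \<and> p $ 2 > 0 \<and> (p $ 3)\<^sup>2 < p $ 1 * p $ 2"
  note pos = this
  have p: "vector [p $ 1, p $ 2, p $ 3] = p" by (simp add: vec_eq_iff forall_3)
  show "sym_mat p \<in> SPD2"
    unfolding SPD2_iff
    by (rule exI[of _ "p $ 1"], rule exI[of _ "p $ 2"], rule exI[of _ "p $ 3"])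
      (use pos p in simp)
qed

lemma sym_mat_coords: "X \<in> SPD2 \<Longrightarrow> sym_mat (coords X) = X"
  by (auto simp: SPD2_iff)

lemma SPD2_dom_iff: "p \<in> SPD2_dom \<longleftrightarrow> p $ 1 > 0 \<and> p $ 2 > 0 \<and> (p $ 3)\<^sup>2 < p $ 1 * p $ 2"
proof -
  have "p \<in> SPD2_dom \<longleftrightarrow> sym_mat p \<in> SPD2"
    unfolding SPD2_dom_def
    by (auto simp: sym_mat_coords intro: image_eqI[of _ _ "sym_mat p"])
  then show ?thesis by (simp add: sym_mat_in_SPD2_iff)
qed

lemma coords_in_SPD2_dom: "X \<in> SPD2 \<Longrightarrow> coords X \<in> SPD2_dom"
  by (simp add: SPD2_dom_def)

lemma open_SPD2_dom: "open SPD2_dom"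
proof -
  have "open ({p :: real^3. 0 < p $ 1} \<inter> {p. 0 < p $ 2} \<inter> {p. (p $ 3)\<^sup>2 < p $ 1 * p $ 2})"
    by (intro open_Int open_Collect_less continuous_intros)
  also have "({p :: real^3. 0 < p $ 1} \<inter> {p. 0 < p $ 2} \<inter> {p. (p $ 3)\<^sup>2 < p $ 1 * p $ 2}) = SPD2_dom"
    by (auto simp: SPD2_dom_iff)
  finally show ?thesis .
qed

section \<open>Affine connections are determined by their Christoffel symbols\<close>

lemma dir_deriv_eq: "(f has_derivative f') (at p) \<Longrightarrow> dir_deriv X f p = f' (X p)"
  unfolding dir_deriv_def by (metis frechet_derivative_at)

lemma affine_connection_expand_left:
  assumes "open U" "affine_connection U D" "smooth_on U X" "smooth_on U Y" "p \<in> U"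
  shows "D X Y p = X p $ 1 *\<^sub>R D (\<lambda>_. axis 1 1) Y p
    + (X p $ 2 *\<^sub>R D (\<lambda>_. axis 2 1) Y p + X p $ 3 *\<^sub>R D (\<lambda>_. axis 3 1) Y p)"
proof -
  have add: "D (\<lambda>q. V q + W q) Y p = D V Y p + D W Y p"
    if "smooth_on U V" "smooth_on U W" for V W
    using assms that by (simp add: affine_connection_def)
  have scale: "D (\<lambda>q. f q *\<^sub>R V q) Y p = f p *\<^sub>R D V Y p"
    if "smooth_on U f" "smooth_on U V" for f V
    using assms that by (simp add: affine_connection_def)
  have "X = (\<lambda>q. X q $ 1 *\<^sub>R axis 1 1 + (X q $ 2 *\<^sub>R axis 2 1 + X q $ 3 *\<^sub>R axis 3 1))"
    using vec3_expand by blast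
  then have "D X Y p = (\<lambda>V. D V Y p)
      (\<lambda>q. X q $ 1 *\<^sub>R axis 1 1 + (X q $ 2 *\<^sub>R axis 2 1 + X q $ 3 *\<^sub>R axis 3 1))"
    by (rule arg_cong[where f = "\<lambda>V. D V Y p"])
  also have "\<dots> = X p $ 1 *\<^sub>R D (\<lambda>_. axis 1 1) Y p
    + (X p $ 2 *\<^sub>R D (\<lambda>_. axis 2 1) Y p + X p $ 3 *\<^sub>R D (\<lambda>_. axis 3 1) Y p)"
    using assms(1,3)
    by (simp add: add scale smooth_on_add smooth_on_scaleR smooth_on_nth smooth_on_const)
  finally show ?thesis .
qed

lemma affine_connection_expand_right:
  assumes "open U" "affine_connection U D" "smooth_on U X" "smooth_on U Y" "p \<in> U"
  defines "T \<equiv> \<lambda>i. Y p $ i *\<^sub>R D X (\<lambda>_. axis i 1) p + dir_deriv X (\<lambda>q. Y q $ i) p *\<^sub>R axis i 1"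
  shows "D X Y p = T 1 + (T 2 + T 3)"
proof -
  have add: "D X (\<lambda>q. V q + W q) p = D X V p + D X W p"
    if "smooth_on U V" "smooth_on U W" for V W
    using assms that unfolding affine_connection_def by blast
  have scale: "D X (\<lambda>q. f q *\<^sub>R V q) p = f p *\<^sub>R D X V p + dir_deriv X f p *\<^sub>R V p"
    if "smooth_on U f" "smooth_on U V" for f V
    using assms that unfolding affine_connection_def by blast
  have "Y = (\<lambda>q. Y q $ 1 *\<^sub>R axis 1 1 + (Y q $ 2 *\<^sub>R axis 2 1 + Y q $ 3 *\<^sub>R axis 3 1))"
    using vec3_expand by blast
  then have "D X Y p = (\<lambda>V. D X V p)
      (\<lambda>q. Y q $ 1 *\<^sub>R axis 1 1 + (Y q $ 2 *\<^sub>R axis 2 1 + Y q $ 3 *\<^sub>R axis 3 1))"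
    by (rule arg_cong[where f = "\<lambda>V. D X V p"])
  also have "\<dots> = T 1 + (T 2 + T 3)"
    using assms(1,4)
    by (simp add: add scale smooth_on_add smooth_on_scaleR smooth_on_nth smooth_on_const T_def)
  finally show ?thesis .
qed

text \<open>The standard basis is a global frame, so the additivity and Leibniz rules express \<open>D X Y\<close>
  through the values of \<open>D\<close> on basis fields. Since component functions exist on the whole
  domain, locality is obtained without cutoff functions.\<close>

lemma affine_connection_eqI:
  assumes "open U" "affine_connection U D" "affine_connection U D'"
    and christoffel: "\<And>i j p. p \<in> U \<Longrightarrow>
      D (\<lambda>_. axis i 1) (\<lambda>_. axis j 1) p = D' (\<lambda>_. axis i 1) (\<lambda>_. axis j 1) p"
    and "smooth_on U X" "smooth_on U Y" "p \<in> U"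
  shows "D X Y p = D' X Y p"
proof -
  have "D (\<lambda>_. axis i 1) Y p = D' (\<lambda>_. axis i 1) Y p" for i
    using affine_connection_expand_right[OF assms(1,2) smooth_on_const assms(6,7)]
      affine_connection_expand_right[OF assms(1,3) smooth_on_const assms(6,7)]
      christoffel[OF assms(7)] by simp
  then show ?thesis
    using affine_connection_expand_left[OF assms(1,2,5,6,7)]
      affine_connection_expand_left[OF assms(1,3,5,6,7)] by simp
qed

section \<open>The three connections as one family\<close>

text \<open>The connections of the theorem are the members \<open>c = 0\<close> (flat), \<open>c = 1\<close> (Levi-Civita) and
  \<open>c = 2\<close> (dual flat) of one family with Christoffel symbols \<open>c/x\<close> and \<open>c/y\<close>. Its geodesics
  satisfy \<open>x'' + c (x')\<^sup>2 / x = 0\<close>, that is, \<open>x ^ (c + 1)\<close> is affine in time.\<close>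

definition power_connection :: "nat \<Rightarrow> conn" where
  "power_connection c X Y p =
     dir_deriv X Y p
       + real c *\<^sub>R vector [X p $ 1 * Y p $ 1 / p $ 1, X p $ 2 * Y p $ 2 / p $ 2, 0]"

lemma affine_power_connection: "affine_connection SPD2_dom (power_connection c)"
proof -
  note op = open_SPD2_dom
  have smooth: "smooth_on SPD2_dom (power_connection c X Y)"
    if "smooth_on SPD2_dom X" "smooth_on SPD2_dom Y" for X Y
    unfolding power_connection_def using that
    by (intro smooth_on_add smooth_on_dir_deriv smooth_on_scaleR smooth_on_const smooth_on_vector3
        smooth_on_divide smooth_on_mult smooth_on_nth smooth_on_ident op)
      (auto simp: SPD2_dom_iff)
  have lin: "linear (frechet_derivative Y (at p))"
    if "smooth_on SPD2_dom Y" "p \<in> SPD2_dom" for p and Y :: vfield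
    using smooth_on_has_derivative[OF that] has_derivative_linear by blast
  have add: "dir_deriv X (\<lambda>q. Y q + Z q) p = dir_deriv X Y p + dir_deriv X Z p"
    if "smooth_on SPD2_dom Y" "smooth_on SPD2_dom Z" "p \<in> SPD2_dom" for p and X Y Z :: vfield
    using dir_deriv_eq[OF has_derivative_add[OF smooth_on_has_derivative smooth_on_has_derivative,
          OF that(1,3,2,3)]]
    by (simp add: dir_deriv_def)
  have leibniz: "dir_deriv X (\<lambda>q. f q *\<^sub>R Y q) p = f p *\<^sub>R dir_deriv X Y p + dir_deriv X f p *\<^sub>R Y p"
    if "smooth_on SPD2_dom f" "smooth_on SPD2_dom Y" "p \<in> SPD2_dom" for p f and X Y :: vfield
    using dir_deriv_eq[OF has_derivative_scaleR[OF smooth_on_has_derivative smooth_on_has_derivative,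
          OF that(1,3,2,3)]]
    by (simp add: dir_deriv_def)
  have left: "dir_deriv (\<lambda>q. X q + X' q) Y p = dir_deriv X Y p + dir_deriv X' Y p"
    "dir_deriv (\<lambda>q. f q *\<^sub>R X q) Y p = f p *\<^sub>R dir_deriv X Y p"
    if "smooth_on SPD2_dom Y" "p \<in> SPD2_dom" for p f and X X' Y :: vfield
    unfolding dir_deriv_def using linear_add[OF lin[OF that]] linear_scale[OF lin[OF that]] by simp_all
  show ?thesis
    unfolding affine_connection_def
    by (intro conjI allI impI ballI smooth)
      (simp_all add: power_connection_def add leibniz left vec_eq_iff forall_3
        add_divide_distrib algebra_simps)
qed

lemma power_connection_const:
  "power_connection c (\<lambda>_. u) (\<lambda>_. v) p
    = real c *\<^sub>R vector [u $ 1 * v $ 1 / p $ 1, u $ 2 * v $ 2 / p $ 2, 0]"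
  by (simp add: power_connection_def dir_deriv_def)

lemma Hess_Phi:
  "Hess Phi p u v = (p $ 1)\<^sup>2 * u $ 1 * v $ 1 + (p $ 2)\<^sup>2 * u $ 2 * v $ 2 + u $ 3 * v $ 3"
proof -
  have nth: "((\<lambda>q :: real^3. q $ i) has_derivative (\<lambda>w. w $ i)) (at q)" for i q
    by (rule bounded_linear_imp_has_derivative[OF bounded_linear_vec_nth])
  have "(Phi has_derivative (\<lambda>w. (q $ 1) ^ 3 / 3 * w $ 1 + (q $ 2) ^ 3 / 3 * w $ 2 + q $ 3 * w $ 3))
      (at q)" for q
    unfolding Phi_def [abs_def]
    by (rule has_derivative_eq_rhs, (rule derivative_intros nth | simp)+)
      (simp add: fun_eq_iff field_simps)
  then have first: "frechet_derivative Phi (at q) v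
      = (q $ 1) ^ 3 / 3 * v $ 1 + (q $ 2) ^ 3 / 3 * v $ 2 + q $ 3 * v $ 3" for q
    by (metis (no_types, lifting) frechet_derivative_at)
  have "((\<lambda>q. (q $ 1) ^ 3 / 3 * v $ 1 + (q $ 2) ^ 3 / 3 * v $ 2 + q $ 3 * v $ 3) has_derivative
      (\<lambda>w. (p $ 1)\<^sup>2 * w $ 1 * v $ 1 + (p $ 2)\<^sup>2 * w $ 2 * v $ 2 + w $ 3 * v $ 3)) (at p)"
    by (rule has_derivative_eq_rhs, (rule derivative_intros nth | simp)+)
      (simp add: fun_eq_iff field_simps)
  from frechet_derivative_at[OF this] show ?thesis
    unfolding Hess_def first by (simp add: fun_eq_iff)
qed

text \<open>Differentiating the coefficient \<open>x\<^sup>2\<close> of the metric produces \<open>2x\<close>, while the Christoffel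
  terms contribute \<open>x\<^sup>2 (a/x + b/x) = (a + b) x\<close>. At \<open>a = b = 1\<close> this is metric compatibility.\<close>

lemma dual_power_connection:
  assumes "a + b = 2"
  shows "dual_connection SPD2_dom (Hess Phi) (power_connection a) (power_connection b)"
  unfolding dual_connection_def
proof (intro conjI allI impI ballI affine_power_connection)
  fix X Y Z :: vfield and p
  assume smooth: "smooth_on SPD2_dom Y" "smooth_on SPD2_dom Z" and p: "p \<in> SPD2_dom"
  define Y' Z' where "Y' = frechet_derivative Y (at p)" and "Z' = frechet_derivative Z (at p)"
  have Y: "((\<lambda>q. Y q $ i) has_derivative (\<lambda>w. Y' w $ i)) (at p)"
    and Z: "((\<lambda>q. Z q $ i) has_derivative (\<lambda>w. Z' w $ i)) (at p)" for i
    unfolding Y'_def Z'_def using smooth[THEN smooth_on_has_derivative, OF p]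
    by (simp_all add: bounded_linear.has_derivative[OF bounded_linear_vec_nth])
  have nth: "((\<lambda>q :: real^3. q $ i) has_derivative (\<lambda>w. w $ i)) (at p)" for i
    by (rule bounded_linear_imp_has_derivative[OF bounded_linear_vec_nth])
  have "((\<lambda>q. Hess Phi q (Y q) (Z q)) has_derivative
      (\<lambda>w. 2 * p $ 1 * w $ 1 * Y p $ 1 * Z p $ 1 + (p $ 1)\<^sup>2 * (Y' w $ 1 * Z p $ 1 + Y p $ 1 * Z' w $ 1)
        + (2 * p $ 2 * w $ 2 * Y p $ 2 * Z p $ 2 + (p $ 2)\<^sup>2 * (Y' w $ 2 * Z p $ 2 + Y p $ 2 * Z' w $ 2))
        + (Y' w $ 3 * Z p $ 3 + Y p $ 3 * Z' w $ 3))) (at p)"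
    unfolding Hess_Phi
    by (rule has_derivative_eq_rhs, (rule derivative_intros nth Y Z | simp)+)
      (simp add: fun_eq_iff algebra_simps)
  note lhs = dir_deriv_eq[OF this, of X]
  have summand: "r\<^sup>2 * (y' + real a * (x * y / r)) * z + r\<^sup>2 * y * (z' + real b * (x * z / r))
      = 2 * r * x * y * z + r\<^sup>2 * (y' * z + y * z')" if "r \<noteq> 0" for r x y z y' z' :: real
  proof -
    have b: "real b = 2 - real a" using assms by linarith
    show ?thesis unfolding b using that by (simp add: field_simps power2_eq_square)
  qed
  show "dir_deriv X (\<lambda>q. Hess Phi q (Y q) (Z q)) p
      = Hess Phi p (power_connection a X Y p) (Z p) + Hess Phi p (Y p) (power_connection b X Z p)"
    using p summand[of "p $ 1" "Y' (X p) $ 1" "X p $ 1" "Y p $ 1" "Z p $ 1" "Z' (X p) $ 1"]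
      summand[of "p $ 2" "Y' (X p) $ 2" "X p $ 2" "Y p $ 2" "Z p $ 2" "Z' (X p) $ 2"]
    unfolding lhs
    by (simp add: Hess_Phi power_connection_def dir_deriv_def Y'_def[symmetric] Z'_def[symmetric]
        SPD2_dom_iff)
qed

lemma levi_civita_power_connection: "levi_civita SPD2_dom (Hess Phi) (power_connection 1)"
  unfolding levi_civita_def
  using dual_power_connection[of 1 1]
  by (simp add: power_connection_def lie_bracket_def mult.commute)

lemma coordinate_system_ident: "coordinate_system U (\<lambda>p. p)"
  by (simp add: coordinate_system_def smooth_on_ident bij_id[unfolded id_def])

lemma coord_vfield_ident: "coord_vfield (\<lambda>p. p) i = (\<lambda>_. axis i 1)"
  by (simp add: coord_vfield_def fun_eq_iff inv_id[unfolded id_def])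

lemma Phi_connections_power_connection:
  "Phi_connections (power_connection 0) (power_connection 2) (power_connection 1)"
  unfolding Phi_connections_def flat_with_affine_coordinates_def
  by (simp add: affine_power_connection coordinate_system_ident coord_vfield_ident
      power_connection_const dual_power_connection levi_civita_power_connection
      del: One_nat_def)

section \<open>Uniqueness of the three connections\<close>

lemma Hess_Phi_nondegenerate:
  assumes "p \<in> SPD2_dom" "\<And>w. Hess Phi p u w = Hess Phi p v w"
  shows "u = v"
  using assms(1) assms(2)[of "axis 1 1"] assms(2)[of "axis 2 1"] assms(2)[of "axis 3 1"]
  by (simp add: Hess_Phi SPD2_dom_iff vec_eq_iff forall_3 axis_def)

lemma Hess_Phi_sym: "Hess Phi p u v = Hess Phi p v u"
  by (simp add: Hess_Phi mult.commute mult.left_commute)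

lemma Hess_Phi_diff: "Hess Phi p (u - v) w = Hess Phi p u w - Hess Phi p v w"
  by (simp add: Hess_Phi algebra_simps)

lemma dual_connectionD:
  assumes "dual_connection U g D D'" "smooth_on U X" "smooth_on U Y" "smooth_on U Z" "p \<in> U"
  shows "g p (D X Y p) (Z p) + g p (Y p) (D' X Z p) = dir_deriv X (\<lambda>q. g q (Y q) (Z q)) p"
  using assms by (simp add: dual_connection_def)

lemma levi_civita_torsion_free:
  assumes "levi_civita U g D" "smooth_on U X" "smooth_on U Y" "p \<in> U"
  shows "D X Y p - D Y X p = lie_bracket X Y p"
  using assms by (simp add: levi_civita_def)

lemma dual_connection_unique:
  assumes "dual_connection SPD2_dom (Hess Phi) D D'" "dual_connection SPD2_dom (Hess Phi) E E'"
    and "\<And>X Y p. smooth_on SPD2_dom X \<Longrightarrow> smooth_on SPD2_dom Y \<Longrightarrow> p \<in> SPD2_dom \<Longrightarrow>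
      D X Y p = E X Y p"
    and "smooth_on SPD2_dom X" "smooth_on SPD2_dom Z" "p \<in> SPD2_dom"
  shows "D' X Z p = E' X Z p"
proof (rule Hess_Phi_nondegenerate[OF assms(6)])
  fix w
  have "Hess Phi p w (D' X Z p) = Hess Phi p w (E' X Z p)"
  proof -
    have "Hess Phi p (D X (\<lambda>_. w) p) (Z p) + Hess Phi p w (D' X Z p)
        = Hess Phi p (E X (\<lambda>_. w) p) (Z p) + Hess Phi p w (E' X Z p)"
      using dual_connectionD[OF assms(1,4) smooth_on_const assms(5,6)]
        dual_connectionD[OF assms(2,4) smooth_on_const assms(5,6)] by simp
    then show ?thesis using assms(3)[OF assms(4) smooth_on_const assms(6), of w] by simp
  qed
  then show "Hess Phi p (D' X Z p) w = Hess Phi p (E' X Z p) w"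
    using Hess_Phi_sym by metis
qed

text \<open>The difference of two Levi-Civita connections, paired with a third field, is symmetric in the
  first two arguments and antisymmetric in the last two; six alternating exchanges return it to
  itself with the opposite sign.\<close>

lemma levi_civita_unique:
  assumes "levi_civita SPD2_dom (Hess Phi) D" "levi_civita SPD2_dom (Hess Phi) E"
    and "smooth_on SPD2_dom X" "smooth_on SPD2_dom Y" "p \<in> SPD2_dom"
  shows "D X Y p = E X Y p"
proof (rule Hess_Phi_nondegenerate[OF assms(5)])
  fix w
  define S where "S = (\<lambda>V W Z. Hess Phi p (D V W p - E V W p) (Z p))"
  have antisym: "S V W Z = - S V Z W"
    if "smooth_on SPD2_dom V" "smooth_on SPD2_dom W" "smooth_on SPD2_dom Z" for V W Z
  proof -
    have dual: "dual_connection SPD2_dom (Hess Phi) D D" "dual_connection SPD2_dom (Hess Phi) E E"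
      using assms(1,2) by (simp_all add: levi_civita_def)
    have "Hess Phi p (D V W p) (Z p) + Hess Phi p (W p) (D V Z p)
        = Hess Phi p (E V W p) (Z p) + Hess Phi p (W p) (E V Z p)"
      using dual[THEN dual_connectionD, OF that assms(5)] by simp
    then show ?thesis
      using Hess_Phi_sym[of p "W p" "D V Z p"] Hess_Phi_sym[of p "W p" "E V Z p"]
      unfolding S_def Hess_Phi_diff by linarith
  qed
  have sym: "S V W Z = S W V Z" if "smooth_on SPD2_dom V" "smooth_on SPD2_dom W" for V W Z
  proof -
    have "D V W p - D W V p = E V W p - E W V p"
      using assms(1,2)[THEN levi_civita_torsion_free, OF that assms(5)] by simp
    then have "D V W p - E V W p = D W V p - E W V p" by (simp add: algebra_simps)
    then show ?thesis by (simp add: S_def)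
  qed
  let ?w = "(\<lambda>_. w) :: vfield"
  have "S X Y ?w = - S X ?w Y" "S X ?w Y = S ?w X Y" "S ?w X Y = - S ?w Y X"
    "S ?w Y X = S Y ?w X" "S Y ?w X = - S Y X ?w" "S Y X ?w = S X Y ?w"
    using antisym[OF assms(3,4) smooth_on_const] sym[OF assms(3) smooth_on_const]
      antisym[OF smooth_on_const assms(3,4)] sym[OF smooth_on_const assms(4)]
      antisym[OF assms(4) smooth_on_const assms(3)] sym[OF assms(4,3)]
    by - assumption+
  then have "S X Y ?w = 0" by linarith
  then show "Hess Phi p (D X Y p) w = Hess Phi p (E X Y p) w"
    by (simp add: S_def Hess_Phi_diff)
qed

lemma Phi_connections_unique:
  assumes "Phi_connections DE DE' DLC"
    and "smooth_on SPD2_dom X" "smooth_on SPD2_dom Y" "p \<in> SPD2_dom"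
  shows "DE X Y p = power_connection 0 X Y p"
    and "DE' X Y p = power_connection 2 X Y p"
    and "DLC X Y p = power_connection 1 X Y p"
proof -
  have conn: "affine_connection SPD2_dom DE" "dual_connection SPD2_dom (Hess Phi) DE DE'"
    "levi_civita SPD2_dom (Hess Phi) DLC"
    and zero: "\<And>i j p. p \<in> SPD2_dom \<Longrightarrow> DE (\<lambda>_. axis i 1) (\<lambda>_. axis j 1) p = 0"
    using assms(1)
    by (simp_all add: Phi_connections_def flat_with_affine_coordinates_def coord_vfield_ident)
  have eq: "DE X Y p = power_connection 0 X Y p"
    if "smooth_on SPD2_dom X" "smooth_on SPD2_dom Y" "p \<in> SPD2_dom" for X Y p
    by (rule affine_connection_eqI[OF open_SPD2_dom conn(1) affine_power_connection _ that])
      (simp add: zero power_connection_const)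
  show "DE X Y p = power_connection 0 X Y p" using assms(2-4) by (rule eq)
  have "dual_connection SPD2_dom (Hess Phi) (power_connection 0) (power_connection 2)"
    by (rule dual_power_connection) simp
  then show "DE' X Y p = power_connection 2 X Y p"
    using eq assms(2-4) by (rule dual_connection_unique[OF conn(2)])
  show "DLC X Y p = power_connection 1 X Y p"
    by (rule levi_civita_unique[OF conn(3) levi_civita_power_connection assms(2-4)])
qed

section \<open>Power charts\<close>

definition power_chart :: "nat \<Rightarrow> real^3 \<Rightarrow> real^3" where
  "power_chart k p = vector [(p $ 1) ^ k, (p $ 2) ^ k, p $ 3]"

definition root_chart :: "nat \<Rightarrow> real^3 \<Rightarrow> real^3" where
  "root_chart k w = vector [root k (w $ 1), root k (w $ 2), w $ 3]"

lemma power_chart_root_chart: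
  assumes "k > 0" "w $ 1 > 0" "w $ 2 > 0"
  shows "power_chart k (root_chart k w) = w"
  using assms by (simp add: power_chart_def root_chart_def vec_eq_iff forall_3)

lemma root_chart_power_chart:
  assumes "k > 0" "p \<in> SPD2_dom"
  shows "root_chart k (power_chart k p) = p"
  using assms
  by (simp add: power_chart_def root_chart_def vec_eq_iff forall_3 SPD2_dom_iff real_root_power_cancel)

text \<open>In the chart the determinant condition becomes a strict inequality between a convex function
  of \<open>z\<close> and the concave geometric mean of the other two coordinates; written with
  \<open>\<bar>z\<bar> ^ k\<close>, it makes the image visibly convex.\<close>

lemma power_chart_image_iff:
  assumes "k > 0"
  shows "w \<in> power_chart k ` SPD2_dom
    \<longleftrightarrow> w $ 1 > 0 \<and> w $ 2 > 0 \<and> \<bar>w $ 3\<bar> ^ k < sqrt (w $ 1 * w $ 2)"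
proof -
  have det: "\<bar>z\<bar> ^ k < sqrt (x ^ k * y ^ k) \<longleftrightarrow> z\<^sup>2 < x * y" if "x > 0" "y > 0" for x y z :: real
  proof -
    have "sqrt (x ^ k * y ^ k) = sqrt (x * y) ^ k"
      by (metis power_mult_distrib real_sqrt_power)
    moreover have "sqrt (x * y) ^ k \<le> \<bar>z\<bar> ^ k \<longleftrightarrow> sqrt (x * y) \<le> \<bar>z\<bar>"
      using assms that by (intro power_mono_iff) auto
    moreover have "sqrt (x * y) \<le> \<bar>z\<bar> \<longleftrightarrow> x * y \<le> z\<^sup>2"
      unfolding real_sqrt_abs[symmetric] by (rule real_sqrt_le_iff)
    ultimately show ?thesis by linarith
  qed
  show ?thesis
  proof
    assume "w \<in> power_chart k ` SPD2_dom"
    then show "w $ 1 > 0 \<and> w $ 2 > 0 \<and> \<bar>w $ 3\<bar> ^ k < sqrt (w $ 1 * w $ 2)"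
      by (auto simp: SPD2_dom_iff power_chart_def det)
  next
    assume w: "w $ 1 > 0 \<and> w $ 2 > 0 \<and> \<bar>w $ 3\<bar> ^ k < sqrt (w $ 1 * w $ 2)"
    then have "root_chart k w \<in> SPD2_dom"
      using assms det[of "root k (w $ 1)" "root k (w $ 2)" "w $ 3"]
      by (simp add: SPD2_dom_iff root_chart_def)
    then show "w \<in> power_chart k ` SPD2_dom"
      using power_chart_root_chart[OF assms, of w] w by (metis image_eqI)
  qed
qed

text \<open>The Cauchy-Schwarz inequality: the cross term \<open>2 sqrt (u v u' v')\<close> is at most
  \<open>u v' + u' v\<close>.\<close>

lemma sqrt_mult_concave:
  fixes u v u' v' a b :: real
  assumes "u \<ge> 0" "v \<ge> 0" "u' \<ge> 0" "v' \<ge> 0" "a \<ge> 0" "b \<ge> 0"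
  shows "a * sqrt (u * v) + b * sqrt (u' * v') \<le> sqrt ((a * u + b * u') * (a * v + b * v'))"
proof (rule real_le_rsqrt)
  have "2 * (sqrt (u * v) * sqrt (u' * v')) \<le> u * v' + u' * v"
    using arith_geo_mean_sqrt[of "u * v'" "u' * v"] assms
    by (simp add: real_sqrt_mult algebra_simps)
  from mult_left_mono[OF this, of "a * b"]
  show "(a * sqrt (u * v) + b * sqrt (u' * v'))\<^sup>2 \<le> (a * u + b * u') * (a * v + b * v')"
    using assms by (simp add: power2_sum power_mult_distrib) (simp add: power2_eq_square algebra_simps)
qed

lemma convex_comb_pos:
  fixes x y a b :: real
  assumes "0 < x" "0 < y" "0 \<le> a" "0 \<le> b" "a + b = 1"
  shows "0 < a * x + b * y"
  using assms by (cases "a = 0") (auto intro: add_pos_nonneg)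

lemma convex_power_nonneg: "convex_on {0::real..} (\<lambda>x. x ^ k)"
  by (cases "even k") (auto intro: convex_power_odd convex_on_subset[OF convex_power_even])

lemma convex_power_chart_image:
  assumes "k > 0"
  shows "convex (power_chart k ` SPD2_dom)"
proof (rule convexI)
  fix w w' :: "real^3" and a b :: real
  assume w: "w \<in> power_chart k ` SPD2_dom" and w': "w' \<in> power_chart k ` SPD2_dom"
    and ab: "0 \<le> a" "0 \<le> b" "a + b = 1"
  note W = w[unfolded power_chart_image_iff[OF assms]] w'[unfolded power_chart_image_iff[OF assms]]
  have comb: "0 < a * x + b * y" if "0 < x" "0 < y" for x y :: real
    using convex_comb_pos that ab by blast
  have "\<bar>a * w $ 3 + b * w' $ 3\<bar> ^ k \<le> (a * \<bar>w $ 3\<bar> + b * \<bar>w' $ 3\<bar>) ^ k"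
    using ab by (intro power_mono) (auto simp: abs_mult intro: order_trans[OF abs_triangle_ineq])
  also have "\<dots> \<le> a * \<bar>w $ 3\<bar> ^ k + b * \<bar>w' $ 3\<bar> ^ k"
    using convex_onD[OF convex_power_nonneg, of b "\<bar>w $ 3\<bar>" "\<bar>w' $ 3\<bar>" k] ab
    by (simp add: eq_diff_eq[symmetric])
  also have "\<dots> < a * sqrt (w $ 1 * w $ 2) + b * sqrt (w' $ 1 * w' $ 2)"
    using W comb[of "sqrt (w $ 1 * w $ 2) - \<bar>w $ 3\<bar> ^ k" "sqrt (w' $ 1 * w' $ 2) - \<bar>w' $ 3\<bar> ^ k"]
    by (simp add: algebra_simps)
  also have "\<dots> \<le> sqrt ((a * w $ 1 + b * w' $ 1) * (a * w $ 2 + b * w' $ 2))"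
    using W ab by (intro sqrt_mult_concave) auto
  finally show "a *\<^sub>R w + b *\<^sub>R w' \<in> power_chart k ` SPD2_dom"
    using W comb by (simp add: power_chart_image_iff[OF assms])
qed

section \<open>Geodesics and midpoint means\<close>

lemma affine_of_second_derivative_zero:
  fixes f f' :: "real \<Rightarrow> real"
  assumes f: "\<And>t. t \<in> {0..1} \<Longrightarrow> (f has_real_derivative f' t) (at t within {0..1})"
    and f': "\<And>t. t \<in> {0..1} \<Longrightarrow> (f' has_real_derivative 0) (at t within {0..1})"
    and t: "t \<in> {0..1}"
  shows "f t = (1 - t) * f 0 + t * f 1"
proof -
  obtain m where m: "\<And>t. t \<in> {0..1} \<Longrightarrow> f' t = m"
    using has_field_derivative_zero_constant[of "{0..1}" f'] f' by auto
  have "((\<lambda>t. f t - m * t) has_real_derivative 0) (at t within {0..1})" if "t \<in> {0..1}" for t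
    using f[OF that] m[OF that] by (auto intro!: derivative_eq_intros)
  then obtain n where n: "\<And>t. t \<in> {0..1} \<Longrightarrow> f t - m * t = n"
    using has_field_derivative_zero_constant[of "{0..1}" "\<lambda>t. f t - m * t"] by auto
  show ?thesis using n[of 0] n[of 1] n[OF t] by (simp add: algebra_simps)
qed

text \<open>Multiplying the equation by the integrating factor \<open>q ^ c\<close> turns it into
  \<open>(q ^ c q')' = 0\<close>, and \<open>q ^ c q'\<close> is, up to a constant, the derivative of \<open>q ^ (c + 1)\<close>.\<close>

lemma power_geodesic_equation:
  fixes q q' q'' :: "real \<Rightarrow> real"
  assumes "\<And>t. t \<in> {0..1} \<Longrightarrow> q t > 0"
    and q: "\<And>t. t \<in> {0..1} \<Longrightarrow> (q has_real_derivative q' t) (at t within {0..1})"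
    and q': "\<And>t. t \<in> {0..1} \<Longrightarrow> (q' has_real_derivative q'' t) (at t within {0..1})"
    and eq: "\<And>t. t \<in> {0..1} \<Longrightarrow> q'' t + real c * (q' t * q' t / q t) = 0"
    and t: "t \<in> {0..1}"
  shows "q t ^ Suc c = (1 - t) * q 0 ^ Suc c + t * q 1 ^ Suc c"
proof (rule affine_of_second_derivative_zero[OF _ _ t])
  fix t :: real assume t: "t \<in> {0..1}"
  show "((\<lambda>t. q t ^ Suc c) has_real_derivative real (Suc c) * q t ^ c * q' t) (at t within {0..1})"
    using DERIV_power[OF q[OF t], of "Suc c"] by (simp add: mult_ac)
  have der: "((\<lambda>t. q t ^ c * q' t) has_real_derivative
      q t ^ c * q'' t + real c * (q' t * q t ^ (c - Suc 0)) * q' t) (at t within {0..1})"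
    using DERIV_mult[OF DERIV_power[OF q[OF t], of c] q'[OF t]] by (simp add: add.commute mult.commute)
  have "real c * q t ^ (c - Suc 0) = real c * q t ^ c / q t"
    using assms(1)[OF t] by (cases c) auto
  then have "(real c * q t ^ (c - Suc 0)) * (q' t * q' t) = q t ^ c * (real c * (q' t * q' t / q t))"
    by simp
  then have "real c * (q' t * q t ^ (c - Suc 0)) * q' t = q t ^ c * (real c * (q' t * q' t / q t))"
    by (simp only: mult_ac)
  moreover have "q t ^ c * (q'' t + real c * (q' t * q' t / q t)) = 0" using eq[OF t] by simp
  ultimately have "((\<lambda>t. q t ^ c * q' t) has_real_derivative 0) (at t within {0..1})"
    using der by (simp only: distrib_left)
  from DERIV_cmult[OF this, of "real (Suc c)"]
  show "((\<lambda>t. real (Suc c) * q t ^ c * q' t) has_real_derivative 0) (at t within {0..1})"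
    by (simp add: mult.assoc)
qed

lemma root_segment_geodesic_equation:
  fixes a b :: real and c :: nat
  assumes "a > 0" "b > 0"
  defines "q \<equiv> \<lambda>t. root (Suc c) ((1 - t) * a + t * b)"
  defines "q' \<equiv> \<lambda>t. (b - a) / (real (Suc c) * q t ^ c)"
  assumes t: "t \<in> {0..1}"
  shows "q t > 0"
    and "(q has_real_derivative q' t) (at t within {0..1})"
    and "(q' has_real_derivative - (real c * (q' t * q' t / q t))) (at t within {0..1})"
proof -
  have "(1 - t) * a + t * b > 0"
    using convex_comb_pos[of a b "1 - t" t] assms by simp
  then show pos: "q t > 0" by (simp add: q_def)
  have "((\<lambda>t. (1 - t) * a + t * b) has_real_derivative b - a) (at t within {0..1})"
    by (auto intro!: derivative_eq_intros)
  from DERIV_chain2[OF DERIV_real_root[of "Suc c"] this]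
  show der: "(q has_real_derivative q' t) (at t within {0..1})"
    using \<open>(1 - t) * a + t * b > 0\<close> by (simp add: q_def q'_def divide_inverse mult.commute)
  have "(q' has_real_derivative
      - ((b - a) * (real (Suc c) * (real c * (q' t * q t ^ (c - Suc 0)))))
        / (real (Suc c) * q t ^ c)\<^sup>2) (at t within {0..1})"
    unfolding q'_def using pos
    by (auto intro!: derivative_eq_intros der simp: q'_def power2_eq_square mult_ac)
  moreover have "real c * q t ^ (c - Suc 0) = real c * q t ^ c / q t"
    using pos by (cases c) auto
  then have "- ((b - a) * (real (Suc c) * (real c * (q' t * q t ^ (c - Suc 0)))))
        / (real (Suc c) * q t ^ c)\<^sup>2 = - (real c * (q' t * q' t / q t))"
  proof -
    assume power: "real c * q t ^ (c - Suc 0) = real c * q t ^ c / q t"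
    have cancel: "- (v * (K * S) * (K * (v * (x * S / y)))) / (K * S)\<^sup>2 = - (x * (v * v / y))"
      if "K \<noteq> 0" "S \<noteq> 0" for K S v x y :: real
      using that by (simp add: power2_eq_square)
    have "b - a = q' t * (real (Suc c) * q t ^ c)"
      using pos by (simp add: q'_def)
    moreover have "real c * (q' t * q t ^ (c - Suc 0)) = q' t * (real c * q t ^ c / q t)"
      by (simp only: power[symmetric] mult_ac)
    ultimately show ?thesis
      using pos cancel[of "real (Suc c)" "q t ^ c" "q' t" "real c" "q t"] by simp
  qed
  ultimately show "(q' has_real_derivative - (real c * (q' t * q' t / q t))) (at t within {0..1})"
    by simp
qed

lemma has_vector_derivative_nth:
  fixes f :: "real \<Rightarrow> real^3"
  assumes "(f has_vector_derivative f') F"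
  shows "((\<lambda>t. f t $ i) has_real_derivative f' $ i) F"
  using bounded_linear.has_vector_derivative[OF bounded_linear_vec_nth assms, of i]
  by (simp add: has_real_derivative_iff_has_vector_derivative)

lemma has_vector_derivative_vector3:
  fixes f g h :: "real \<Rightarrow> real"
  assumes "(f has_real_derivative f') F" "(g has_real_derivative g') F" "(h has_real_derivative h') F"
  shows "((\<lambda>t. vector [f t, g t, h t] :: real^3) has_vector_derivative vector [f', g', h']) F"
proof -
  have "((\<lambda>t. vector [f t, g t, h t] :: real^3) has_derivative
      (\<lambda>x. vector [f' * x, g' * x, h' * x])) F"
    using assms unfolding has_field_derivative_def by (rule has_derivative_vector3)
  moreover have "(\<lambda>x. vector [f' * x, g' * x, h' * x] :: real^3) = (\<lambda>x. x *\<^sub>R vector [f', g', h'])"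
    by (simp add: fun_eq_iff vec_eq_iff forall_3)
  ultimately show ?thesis by (simp add: has_vector_derivative_def)
qed

text \<open>The geodesic equation sees a connection only through the quadratic form
  \<open>v \<mapsto> D v v\<close> on constant fields, its spray. Working with the spray makes the results on
  geodesics apply to every connection that agrees with \<open>power_connection c\<close> on smooth fields.\<close>

definition has_power_spray :: "nat \<Rightarrow> conn \<Rightarrow> bool" where
  "has_power_spray c D \<longleftrightarrow> (\<forall>p\<in>SPD2_dom. \<forall>v. D (\<lambda>_. v) (\<lambda>_. v) p
     = real c *\<^sub>R vector [v $ 1 * v $ 1 / p $ 1, v $ 2 * v $ 2 / p $ 2, 0])"

text \<open>The straight segment of the power chart, carried back to matrices. It stays positive definite
  because the image of the chart is convex.\<close>

definition power_segment :: "nat \<Rightarrow> real^2^2 \<Rightarrow> real^2^2 \<Rightarrow> real \<Rightarrow> real^2^2" where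
  "power_segment k P Q t = sym_mat (root_chart k
     ((1 - t) *\<^sub>R power_chart k (coords P) + t *\<^sub>R power_chart k (coords Q)))"

definition power_mean :: "nat \<Rightarrow> real^2^2 \<Rightarrow> real^2^2 \<Rightarrow> real^2^2" where
  "power_mean k P Q = power_segment k P Q (1/2)"

lemma power_segment_in_SPD2:
  assumes "k > 0" "P \<in> SPD2" "Q \<in> SPD2" "t \<in> {0..1}"
  shows "power_segment k P Q t \<in> SPD2"
proof -
  have "(1 - t) *\<^sub>R power_chart k (coords P) + t *\<^sub>R power_chart k (coords Q)
      \<in> power_chart k ` SPD2_dom"
    using assms by (intro convexD[OF convex_power_chart_image] imageI coords_in_SPD2_dom) auto
  then obtain p where "p \<in> SPD2_dom"
    and "(1 - t) *\<^sub>R power_chart k (coords P) + t *\<^sub>R power_chart k (coords Q) = power_chart k p"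
    by blast
  then show ?thesis
    using root_chart_power_chart[OF assms(1)]
    by (simp add: power_segment_def sym_mat_in_SPD2_iff SPD2_dom_iff)
qed

lemma geodesic_power_segment:
  assumes D: "has_power_spray c D"
    and P: "P \<in> SPD2" and Q: "Q \<in> SPD2"
  shows "geodesic D P Q (power_segment (Suc c) P Q)"
proof -
  let ?g = "power_segment (Suc c) P Q"
  let ?P = "coords P" and ?Q = "coords Q"
  have dom: "?P \<in> SPD2_dom" "?Q \<in> SPD2_dom" using P Q coords_in_SPD2_dom by auto
  then have pos: "?P $ 1 > 0" "?P $ 2 > 0" "?Q $ 1 > 0" "?Q $ 2 > 0" by (auto simp: SPD2_dom_iff)
  define q where "q = (\<lambda>i t. root (Suc c) ((1 - t) * ?P $ i ^ Suc c + t * ?Q $ i ^ Suc c))"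
  define q' where "q' = (\<lambda>i t. (?Q $ i ^ Suc c - ?P $ i ^ Suc c) / (real (Suc c) * q i t ^ c))"
  define q'' where "q'' = (\<lambda>i t. - (real c * (q' i t * q' i t / q i t)))"
  have q: "q i t > 0" "(q i has_real_derivative q' i t) (at t within {0..1})"
    "(q' i has_real_derivative q'' i t) (at t within {0..1})"
    if "i \<in> {1, 2}" "t \<in> {0..1}" for i t
    using root_segment_geodesic_equation[of "?P $ i ^ Suc c" "?Q $ i ^ Suc c" t c] pos that
    unfolding q_def q'_def q''_def by auto
  have coords: "coords (?g t) = vector [q 1 t, q 2 t, (1 - t) * ?P $ 3 + t * ?Q $ 3]" for t
    by (simp add: power_segment_def root_chart_def power_chart_def q_def)
  define c' where "c' = (\<lambda>t. vector [q' 1 t, q' 2 t, ?Q $ 3 - ?P $ 3] :: real^3)"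
  define c'' where "c'' = (\<lambda>t. vector [q'' 1 t, q'' 2 t, 0] :: real^3)"
  have "((\<lambda>r. coords (?g r)) has_vector_derivative c' t) (at t within {0..1})"
    and "(c' has_vector_derivative c'' t) (at t within {0..1})"
    and "c'' t + D (\<lambda>_. c' t) (\<lambda>_. c' t) (coords (?g t)) = 0" if t: "t \<in> {0..1}" for t
  proof -
    show "((\<lambda>r. coords (?g r)) has_vector_derivative c' t) (at t within {0..1})"
      unfolding coords c'_def using t
      by (intro has_vector_derivative_vector3 q) (auto intro!: derivative_eq_intros)
    show "(c' has_vector_derivative c'' t) (at t within {0..1})"
      unfolding c'_def c''_def using t by (intro has_vector_derivative_vector3 q) auto
    have "coords (?g t) \<in> SPD2_dom"
      using power_segment_in_SPD2[OF _ P Q t] coords_in_SPD2_dom by blast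
    then show "c'' t + D (\<lambda>_. c' t) (\<lambda>_. c' t) (coords (?g t)) = 0"
      using D unfolding has_power_spray_def
      by (simp add: coords c'_def c''_def q''_def vec_eq_iff forall_3)
  qed
  moreover have "?g 0 = P" "?g 1 = Q"
    using root_chart_power_chart[OF _ dom(1)] root_chart_power_chart[OF _ dom(2)] P Q
    by (simp_all add: power_segment_def sym_mat_coords)
  ultimately show ?thesis
    unfolding geodesic_def using power_segment_in_SPD2[OF _ P Q] by blast
qed

lemma geodesic_eq_power_segment:
  assumes D: "has_power_spray c D"
    and geo: "geodesic D P Q \<gamma>" and t: "t \<in> {0..1}"
  shows "\<gamma> t = power_segment (Suc c) P Q t"
proof -
  define r where "r = (\<lambda>t. coords (\<gamma> t))"
  have ends: "\<gamma> 0 = P" "\<gamma> 1 = Q" and mem: "\<And>t. t \<in> {0..1} \<Longrightarrow> \<gamma> t \<in> SPD2"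
    using geo by (auto simp: geodesic_def)
  obtain r' r'' where
    r: "\<And>t. t \<in> {0..1} \<Longrightarrow> (r has_vector_derivative r' t) (at t within {0..1})"
    and r': "\<And>t. t \<in> {0..1} \<Longrightarrow> (r' has_vector_derivative r'' t) (at t within {0..1})"
    and eq: "\<And>t. t \<in> {0..1} \<Longrightarrow> r'' t + D (\<lambda>_. r' t) (\<lambda>_. r' t) (r t) = 0"
    using geo unfolding geodesic_def r_def by blast
  have dom: "r t \<in> SPD2_dom" if "t \<in> {0..1}" for t
    using coords_in_SPD2_dom[OF mem[OF that]] by (simp add: r_def)
  have eqs: "r'' t $ 1 + real c * (r' t $ 1 * r' t $ 1 / r t $ 1) = 0"
    "r'' t $ 2 + real c * (r' t $ 2 * r' t $ 2 / r t $ 2) = 0" "r'' t $ 3 = 0"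
    if "t \<in> {0..1}" for t
    using eq[OF that] D dom[OF that] unfolding has_power_spray_def
    by (simp_all add: vec_eq_iff forall_3)
  have "r t $ i ^ Suc c = (1 - t) * r 0 $ i ^ Suc c + t * r 1 $ i ^ Suc c" if "i \<in> {1, 2}" for i
    using that dom eqs
    by (intro power_geodesic_equation[OF _ has_vector_derivative_nth[OF r]
          has_vector_derivative_nth[OF r'] _ t]) (auto simp: SPD2_dom_iff)
  moreover have "r t $ 3 = (1 - t) * r 0 $ 3 + t * r 1 $ 3"
    using eqs(3) has_vector_derivative_nth[OF r', of _ 3]
    by (intro affine_of_second_derivative_zero[OF has_vector_derivative_nth[OF r] _ t]) auto
  ultimately have "power_chart (Suc c) (r t)
      = (1 - t) *\<^sub>R power_chart (Suc c) (r 0) + t *\<^sub>R power_chart (Suc c) (r 1)"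
    by (simp add: power_chart_def vec_eq_iff forall_3 del: power_Suc)
  then have "power_segment (Suc c) P Q t = sym_mat (root_chart (Suc c) (power_chart (Suc c) (r t)))"
    by (simp add: power_segment_def r_def ends)
  then show ?thesis
    using root_chart_power_chart[OF _ dom[OF t]] sym_mat_coords[OF mem[OF t]] by (simp add: r_def)
qed

lemma is_midpoint_iff:
  assumes D: "has_power_spray c D"
    and "P \<in> SPD2" "Q \<in> SPD2"
  shows "is_midpoint D P Q R \<longleftrightarrow> R = power_mean (Suc c) P Q"
proof
  assume "is_midpoint D P Q R"
  then show "R = power_mean (Suc c) P Q"
    using geodesic_eq_power_segment[OF D, of P Q _ "1/2"]
    by (auto simp: is_midpoint_def power_mean_def)
next
  assume "R = power_mean (Suc c) P Q"
  moreover have "\<delta> t = power_segment (Suc c) P Q t" if "geodesic D P Q \<delta>" "t \<in> {0..1}" for \<delta> t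
    using D that by (rule geodesic_eq_power_segment)
  ultimately show "is_midpoint D P Q R"
    using geodesic_power_segment[OF assms] unfolding is_midpoint_def power_mean_def by blast
qed

lemma midpoint_mean_power:
  assumes D: "has_power_spray c D"
    and "P \<in> SPD2" "Q \<in> SPD2"
  shows "midpoint_mean_defined D P Q" "midpoint_mean D P Q = power_mean (Suc c) P Q"
proof -
  have "is_midpoint D P Q = (\<lambda>R. R = power_mean (Suc c) P Q)"
    using is_midpoint_iff[OF assms] by blast
  then show "midpoint_mean_defined D P Q" "midpoint_mean D P Q = power_mean (Suc c) P Q"
    unfolding midpoint_mean_defined_def midpoint_mean_def by simp_all
qed

section \<open>The dual affine coordinates\<close>

definition scale_thirds :: "real^3 \<Rightarrow> real^3" where
  "scale_thirds w = vector [w $ 1 / 3, w $ 2 / 3, w $ 3]"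

lemma linear_scale_thirds: "linear scale_thirds"
  by (rule linearI)
    (simp_all add: scale_thirds_def vec_eq_iff forall_3 add_divide_distrib)

lemma eta_power_chart: "eta p = scale_thirds (power_chart 3 p)"
  by (simp add: eta_def scale_thirds_def power_chart_def)

lemma convex_eta_image: "convex (eta ` SPD2_dom)"
proof -
  have "eta = scale_thirds \<circ> power_chart 3"
    by (rule ext) (simp add: eta_power_chart)
  then have "eta ` SPD2_dom = scale_thirds ` power_chart 3 ` SPD2_dom"
    by (simp only: image_comp)
  then show ?thesis
    using convex_linear_image[OF linear_scale_thirds convex_power_chart_image[of 3]] by simp
qed

lemma inj_on_eta: "inj_on eta SPD2_dom"
proof (rule inj_onI)
  fix p q assume p: "p \<in> SPD2_dom" and q: "q \<in> SPD2_dom" and "eta p = eta q"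
  then have "p $ 1 ^ 3 = q $ 1 ^ 3" "p $ 2 ^ 3 = q $ 2 ^ 3" "p $ 3 = q $ 3"
    by (simp_all add: eta_def vec_eq_iff forall_3)
  then have "power_chart 3 p = power_chart 3 q" by (simp add: power_chart_def)
  then show "p = q"
    using root_chart_power_chart[OF _ p, of 3] root_chart_power_chart[OF _ q, of 3] zero_less_numeral by metis
qed

lemma eta_has_derivative:
  "(eta has_derivative (\<lambda>v. vector [(p $ 1)\<^sup>2 * v $ 1, (p $ 2)\<^sup>2 * v $ 2, v $ 3])) (at p)"
proof -
  have nth: "((\<lambda>q :: real^3. q $ i) has_derivative (\<lambda>w. w $ i)) (at p)" for i
    by (rule bounded_linear_imp_has_derivative[OF bounded_linear_vec_nth])
  have cube: "((\<lambda>q :: real^3. (q $ i) ^ 3 / 3) has_derivative (\<lambda>w. (p $ i)\<^sup>2 * w $ i)) (at p)" for i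
    by (rule has_derivative_eq_rhs, (rule derivative_intros nth | simp)+)
      (simp add: fun_eq_iff field_simps)
  show ?thesis
    unfolding eta_def[abs_def] by (intro has_derivative_vector3 cube nth)
qed

lemma inv_frechet_derivative_eta:
  assumes "p \<in> SPD2_dom"
  shows "bij (frechet_derivative eta (at p))"
    and "inv (frechet_derivative eta (at p)) = (\<lambda>v. vector [v $ 1 / (p $ 1)\<^sup>2, v $ 2 / (p $ 2)\<^sup>2, v $ 3])"
proof -
  have inverse:
    "frechet_derivative eta (at p) (vector [v $ 1 / (p $ 1)\<^sup>2, v $ 2 / (p $ 2)\<^sup>2, v $ 3]) = v"
    "vector [frechet_derivative eta (at p) v $ 1 / (p $ 1)\<^sup>2,
       frechet_derivative eta (at p) v $ 2 / (p $ 2)\<^sup>2, frechet_derivative eta (at p) v $ 3] = v" for v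
    using assms unfolding frechet_derivative_at[OF eta_has_derivative, symmetric]
    by (simp_all add: SPD2_dom_iff vec_eq_iff forall_3)
  show "bij (frechet_derivative eta (at p))"
    by (rule bij_betw_byWitness[where f' = "\<lambda>v. vector [v $ 1 / (p $ 1)\<^sup>2, v $ 2 / (p $ 2)\<^sup>2, v $ 3]"])
      (simp_all add: inverse)
  show "inv (frechet_derivative eta (at p)) = (\<lambda>v. vector [v $ 1 / (p $ 1)\<^sup>2, v $ 2 / (p $ 2)\<^sup>2, v $ 3])"
    by (rule inv_equality) (simp_all add: inverse)
qed

lemma smooth_eta: "open U \<Longrightarrow> smooth_on U eta"
  unfolding eta_def[abs_def]
  by (intro smooth_on_vector3 smooth_on_divide smooth_on_power smooth_on_nth smooth_on_ident
      smooth_on_const) auto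

lemma eta_frame:
  assumes "p \<in> SPD2_dom"
  shows "coord_vfield eta i p
    = vector [axis i 1 $ 1 / (p $ 1)\<^sup>2, axis i 1 $ 2 / (p $ 2)\<^sup>2, axis i 1 $ 3]"
  by (simp add: coord_vfield_def inv_frechet_derivative_eta(2)[OF assms])

lemma smooth_eta_frame: "smooth_on SPD2_dom (coord_vfield eta i)"
proof -
  have "smooth_on SPD2_dom (\<lambda>p :: real^3.
      vector [axis i 1 $ 1 / (p $ 1)\<^sup>2, axis i 1 $ 2 / (p $ 2)\<^sup>2, axis i 1 $ 3] :: real^3)"
    by (intro smooth_on_vector3 smooth_on_divide smooth_on_power smooth_on_nth smooth_on_ident
        smooth_on_const open_SPD2_dom) (auto simp: SPD2_dom_iff)
  then show ?thesis
    using smooth_on_cong[OF open_SPD2_dom eta_frame[of _ i]] by simp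
qed

text \<open>The frame field in the direction \<open>x\<close> is \<open>(1/x\<^sup>2) d/dx\<close>: the derivative of its coefficient contributes
  \<open>-2/x ^ 5\<close>, which the Christoffel symbol \<open>2/x\<close> cancels.\<close>

lemma power_connection_eta_frame:
  assumes p: "p \<in> SPD2_dom"
  shows "power_connection 2 (coord_vfield eta i) (coord_vfield eta j) p = 0"
proof -
  have nz: "p $ 1 \<noteq> 0" "p $ 2 \<noteq> 0" using p by (auto simp: SPD2_dom_iff)
  have nth: "((\<lambda>q :: real^3. q $ i) has_derivative (\<lambda>w. w $ i)) (at p)" for i
    by (rule bounded_linear_imp_has_derivative[OF bounded_linear_vec_nth])
  have quot: "((\<lambda>q. e / (q $ k)\<^sup>2) has_derivative (\<lambda>w. - (2 * e * w $ k / (p $ k) ^ 3))) (at p)"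
    if "p $ k \<noteq> 0" for e :: real and k
    by (rule has_derivative_eq_rhs, (rule derivative_intros nth | simp add: that)+)
      (use that in \<open>simp add: fun_eq_iff field_simps power_numeral_reduce\<close>)
  have "((\<lambda>p. vector [axis j 1 $ 1 / (p $ 1)\<^sup>2, axis j 1 $ 2 / (p $ 2)\<^sup>2, axis j 1 $ 3] :: real^3)
      has_derivative (\<lambda>w. vector [- (2 * axis j 1 $ 1 * w $ 1 / (p $ 1) ^ 3),
        - (2 * axis j 1 $ 2 * w $ 2 / (p $ 2) ^ 3), 0])) (at p)"
    using nz by (intro has_derivative_vector3 quot has_derivative_const)
  then have "(coord_vfield eta j has_derivative (\<lambda>w. vector [- (2 * axis j 1 $ 1 * w $ 1 / (p $ 1) ^ 3),
        - (2 * axis j 1 $ 2 * w $ 2 / (p $ 2) ^ 3), 0])) (at p)"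
    by (rule has_derivative_transform_within_open[OF _ open_SPD2_dom p]) (simp add: eta_frame)
  note der = dir_deriv_eq[OF this, of "coord_vfield eta i"]
  show ?thesis
    unfolding power_connection_def der eta_frame[OF p] using nz
    by (simp add: vec_eq_iff forall_3 power_numeral_reduce)
qed

lemma flat_eta:
  assumes "affine_connection SPD2_dom D"
    and "\<And>X Y p. smooth_on SPD2_dom X \<Longrightarrow> smooth_on SPD2_dom Y \<Longrightarrow> p \<in> SPD2_dom \<Longrightarrow>
      D X Y p = power_connection 2 X Y p"
  shows "flat_with_affine_coordinates SPD2_dom D eta"
  unfolding flat_with_affine_coordinates_def coordinate_system_def
  by (simp add: assms smooth_eta[OF open_SPD2_dom] inj_on_eta inv_frechet_derivative_eta(1)
      smooth_eta_frame power_connection_eta_frame)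

section \<open>Explicit means\<close>

lemma power_mean_one:
  assumes "P \<in> SPD2" "Q \<in> SPD2"
  shows "power_mean 1 P Q = (1/2) *\<^sub>R (P + Q)"
proof -
  have "power_mean 1 P Q = (1/2) *\<^sub>R (sym_mat (coords P) + sym_mat (coords Q))"
    by (simp add: power_mean_def power_segment_def root_chart_def power_chart_def sym_mat_def
        vec_eq_iff forall_2 forall_3 algebra_simps)
  then show ?thesis using assms by (simp add: sym_mat_coords)
qed

lemma power_mean_three:
  assumes P: "P \<in> SPD2" and Q: "Q \<in> SPD2"
  shows "power_mean 3 P Q = sym_mat (the_inv_into SPD2_dom eta
    ((1/2) *\<^sub>R (eta (coords P) + eta (coords Q))))"
proof -
  let ?w = "(1/2) *\<^sub>R power_chart 3 (coords P) + (1/2) *\<^sub>R power_chart 3 (coords Q)"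
  have mem: "root_chart 3 ?w \<in> SPD2_dom"
    using power_segment_in_SPD2[of 3 P Q "1/2"] P Q
    by (simp add: power_segment_def SPD2_dom_iff sym_mat_in_SPD2_iff)
  have "?w $ 1 > 0" "?w $ 2 > 0"
    using coords_in_SPD2_dom[OF P] coords_in_SPD2_dom[OF Q]
    by (simp_all add: SPD2_dom_iff power_chart_def add_pos_pos)
  then have "eta (root_chart 3 ?w) = scale_thirds ?w"
    by (simp only: eta_power_chart power_chart_root_chart zero_less_numeral)
  also have "\<dots> = (1/2) *\<^sub>R (eta (coords P) + eta (coords Q))"
    by (simp add: eta_power_chart linear_add[OF linear_scale_thirds]
        linear_scale[OF linear_scale_thirds] scaleR_add_right)
  finally have "the_inv_into SPD2_dom eta ((1/2) *\<^sub>R (eta (coords P) + eta (coords Q)))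
      = root_chart 3 ?w"
    by (rule the_inv_into_f_eq[OF inj_on_eta _ mem])
  then show ?thesis by (simp add: power_mean_def power_segment_def)
qed

lemma scalar_mat_sym_mat: "scalar_mat s = sym_mat (vector [s, s, 0])"
  by (simp add: sym_mat_def mat_def vec_eq_iff forall_2)

lemma scalar_mat_in_SPD2: "s > 0 \<Longrightarrow> scalar_mat s \<in> SPD2"
  by (simp add: scalar_mat_sym_mat sym_mat_in_SPD2_iff)

lemma scalar_mat_inject: "scalar_mat s = scalar_mat t \<longleftrightarrow> s = t"
proof
  assume "scalar_mat s = scalar_mat t"
  then have "scalar_mat s $ 1 $ 1 = scalar_mat t $ 1 $ 1" by (rule arg_cong)
  then show "s = t" by (simp add: mat_def)
qed simp

definition real_power_mean :: "nat \<Rightarrow> real \<Rightarrow> real \<Rightarrow> real" where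
  "real_power_mean k s t = root k ((s ^ k + t ^ k) / 2)"

lemma power_mean_scalar_mat:
  "power_mean k (scalar_mat s) (scalar_mat t) = scalar_mat (real_power_mean k s t)"
  unfolding scalar_mat_sym_mat
  by (simp add: power_mean_def power_segment_def power_chart_def root_chart_def
      real_power_mean_def add_divide_distrib)

lemma real_power_mean_pos: "k > 0 \<Longrightarrow> s > 0 \<Longrightarrow> t > 0 \<Longrightarrow> real_power_mean k s t > 0"
  by (simp add: real_power_mean_def add_pos_pos)

lemma real_power_mean_one: "real_power_mean 1 s t = (s + t) / 2"
  by (simp add: real_power_mean_def)

section \<open>The Gauss iteration on scalar matrices\<close>

text \<open>With \<open>s = a + d\<close> and \<open>t = a - d\<close> the claim says that \<open>m\<^sup>2 < a\<^sup>2 + 2 d\<^sup>2\<close>, where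
  \<open>m ^ 3 = a ^ 3 + 3 a d\<^sup>2\<close>; after cubing, the two sides differ by
  \<open>3 a\<^sup>2 d ^ 4 + 8 d ^ 6\<close>. This single inequality yields both the failure of invariance and
  the strict bound on the Gauss limit.\<close>

lemma mean_squares_less:
  assumes "s > 0" "t > 0" "s \<noteq> t"
  shows "(real_power_mean 1 s t)\<^sup>2 + (real_power_mean 3 s t)\<^sup>2 < s\<^sup>2 + t\<^sup>2"
proof -
  define a d where "a = (s + t) / 2" and "d = (s - t) / 2"
  have st: "s = a + d" "t = a - d" by (simp_all add: a_def d_def field_simps)
  have d: "d \<noteq> 0" using assms by (simp add: d_def)
  let ?m = "real_power_mean 3 s t"
  have "?m ^ 3 = a ^ 3 + 3 * a * d\<^sup>2"
    using assms unfolding real_power_mean_def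
    by (simp add: add_pos_pos) (simp add: st power_numeral_reduce field_simps)
  then have "(?m\<^sup>2) ^ 3 = (a ^ 3 + 3 * a * d\<^sup>2)\<^sup>2"
    by (metis mult.commute power_mult)
  also have "\<dots> = (a\<^sup>2 + 2 * d\<^sup>2) ^ 3 - (3 * (a * d\<^sup>2)\<^sup>2 + 8 * (d ^ 3)\<^sup>2)"
    by (simp add: power_numeral_reduce algebra_simps)
  also have "\<dots> < (a\<^sup>2 + 2 * d\<^sup>2) ^ 3"
  proof -
    have "(d ^ 3)\<^sup>2 > 0" using d by simp
    moreover have "(a * d\<^sup>2)\<^sup>2 \<ge> 0" by simp
    ultimately show ?thesis by linarith
  qed
  finally have "?m\<^sup>2 < a\<^sup>2 + 2 * d\<^sup>2"
    by (rule power_less_imp_less_base) simp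
  moreover have "s\<^sup>2 + t\<^sup>2 = 2 * a\<^sup>2 + 2 * d\<^sup>2"
    by (simp add: st power2_eq_square algebra_simps)
  ultimately show ?thesis by (simp add: real_power_mean_one a_def del: One_nat_def)
qed

lemma mean_squares_le:
  assumes "s > 0" "t > 0"
  shows "(real_power_mean 1 s t)\<^sup>2 + (real_power_mean 3 s t)\<^sup>2 \<le> s\<^sup>2 + t\<^sup>2"
proof (cases "s = t")
  case True
  then show ?thesis using assms by (simp add: real_power_mean_def real_root_power_cancel)
next
  case False
  then show ?thesis using mean_squares_less[OF assms] by simp
qed

lemma real_power_mean_one_le_three:
  assumes "s > 0" "t > 0"
  shows "real_power_mean 1 s t \<le> real_power_mean 3 s t"
proof -
  have "(s ^ 3 + t ^ 3) / 2 - ((s + t) / 2) ^ 3 = 3 / 8 * ((s + t) * (s - t)\<^sup>2)"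
    by (simp add: power_numeral_reduce field_simps)
  moreover have "(s + t) * (s - t)\<^sup>2 \<ge> 0" using assms by simp
  ultimately have "((s + t) / 2) ^ 3 \<le> (s ^ 3 + t ^ 3) / 2" by linarith
  then have "root 3 (((s + t) / 2) ^ 3) \<le> root 3 ((s ^ 3 + t ^ 3) / 2)" by simp
  then show ?thesis
    using assms unfolding real_power_mean_one by (simp add: real_power_mean_def odd_real_root_power_cancel)
qed

lemma real_power_mean_le:
  assumes "0 < s" "s \<le> t" "k > 0"
  shows "real_power_mean k s t \<le> t"
proof -
  have "(s ^ k + t ^ k) / 2 \<le> t ^ k" using power_mono[of s t k] assms by simp
  then have "root k ((s ^ k + t ^ k) / 2) \<le> root k (t ^ k)" using assms by simp
  then show ?thesis using assms by (simp add: real_power_mean_def real_root_power_cancel)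
qed

abbreviation scalar_gauss :: "real \<Rightarrow> real \<Rightarrow> nat \<Rightarrow> real \<times> real" where
  "scalar_gauss \<equiv> gauss_seq (real_power_mean 1) (real_power_mean 3)"

lemma scalar_gauss_Suc:
  "scalar_gauss s t (Suc n) =
    (real_power_mean 1 (fst (scalar_gauss s t n)) (snd (scalar_gauss s t n)),
     real_power_mean 3 (fst (scalar_gauss s t n)) (snd (scalar_gauss s t n)))"
  by (simp add: Let_def case_prod_beta del: One_nat_def)

lemma scalar_gauss_pos_le:
  assumes "0 < s" "s \<le> t"
  shows "0 < fst (scalar_gauss s t n) \<and> fst (scalar_gauss s t n) \<le> snd (scalar_gauss s t n)"
proof (induction n)
  case 0
  then show ?case using assms by simp
next
  case (Suc n)
  then show ?case
    unfolding scalar_gauss_Suc using real_power_mean_one_le_three real_power_mean_pos by simp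
qed

text \<open>The arithmetic mean stays below the cubic one and the cubic one below the larger entry, so
  the entries enclose a limit while their distance is at least halved. The sum of squares
  decreases strictly in the first step and never increases afterwards, hence the strict bound.\<close>

lemma scalar_gauss_limit:
  assumes "0 < s" "s < t"
  obtains L where "(\<lambda>n. fst (scalar_gauss s t n)) \<longlonglongrightarrow> L" "(\<lambda>n. snd (scalar_gauss s t n)) \<longlonglongrightarrow> L"
    and "0 < L" "2 * L\<^sup>2 < s\<^sup>2 + t\<^sup>2"
proof -
  define f where "f = (\<lambda>n. fst (scalar_gauss s t n))"
  define g where "g = (\<lambda>n. snd (scalar_gauss s t n))"
  have step: "f (Suc n) = real_power_mean 1 (f n) (g n)" "g (Suc n) = real_power_mean 3 (f n) (g n)" for n
    unfolding f_def g_def by (simp_all only: scalar_gauss_Suc fst_conv snd_conv)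
  have inv: "0 < f n" "f n \<le> g n" for n
    using scalar_gauss_pos_le[of s t n] assms by (simp_all add: f_def g_def)
  have inc: "f n \<le> f (Suc n)" and dec: "g (Suc n) \<le> g n" for n
    using inv[of n] by (simp_all add: step real_power_mean_one real_power_mean_le del: One_nat_def)
  have gap: "g n - f n \<le> (t - s) * (1/2) ^ n" for n
  proof (induction n)
    case 0
    then show ?case by (simp add: f_def g_def)
  next
    case (Suc n)
    have halve: "y' - x' \<le> (y - x) / 2" if "y' \<le> y" "x' = (x + y) / 2" for x y x' y' :: real
      using that by simp
    have "g (Suc n) - f (Suc n) \<le> (g n - f n) / 2"
      using halve[OF dec[of n]] step(1)[of n] unfolding real_power_mean_one by blast
    then show ?case using Suc by simp
  qed
  have "(\<lambda>n. (t - s) * (1/2) ^ n) \<longlonglongrightarrow> 0"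
    by (intro tendsto_mult_right_zero LIMSEQ_realpow_zero) auto
  then have "(\<lambda>n. f n - g n) \<longlonglongrightarrow> 0"
    by (rule Lim_null_comparison[rotated]) (use gap inv in simp)
  then obtain L where L: "\<And>n. f n \<le> L" "f \<longlonglongrightarrow> L" "g \<longlonglongrightarrow> L"
    using nested_sequence_unique[of f g] inc dec inv by blast
  have sq: "(f (Suc n))\<^sup>2 + (g (Suc n))\<^sup>2 \<le> (f 1)\<^sup>2 + (g 1)\<^sup>2" for n
  proof (induction n)
    case 0
    then show ?case by simp
  next
    case (Suc n)
    have "0 < g (Suc n)" using inv[of "Suc n"] by simp
    then show ?case
      using mean_squares_le[OF inv(1)[of "Suc n"]] Suc.IH
      unfolding step[of "Suc n"] by (meson order_trans)
  qed
  have "(\<lambda>n. (f (Suc n))\<^sup>2 + (g (Suc n))\<^sup>2) \<longlonglongrightarrow> L\<^sup>2 + L\<^sup>2"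
    using L(2,3) by (intro tendsto_intros LIMSEQ_Suc)
  then have "L\<^sup>2 + L\<^sup>2 \<le> (f 1)\<^sup>2 + (g 1)\<^sup>2"
    by (rule LIMSEQ_le_const2) (use sq in blast)
  also have "\<dots> < s\<^sup>2 + t\<^sup>2"
    using mean_squares_less[of s t] assms step[of 0] by (simp add: f_def g_def)
  finally have "2 * L\<^sup>2 < s\<^sup>2 + t\<^sup>2" by simp
  moreover have "0 < L" using inv(1)[of 0] L(1)[of 0] by simp
  ultimately show ?thesis using that L(2,3) by (simp add: f_def g_def)
qed

text \<open>Scalar matrices are preserved by all the means, which reduces the matrix iteration to the
  one on real numbers.\<close>

lemma gauss_seq_scalar_mat:
  assumes A: "\<And>P Q. P \<in> SPD2 \<Longrightarrow> Q \<in> SPD2 \<Longrightarrow> A P Q = power_mean 1 P Q"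
    and M: "\<And>P Q. P \<in> SPD2 \<Longrightarrow> Q \<in> SPD2 \<Longrightarrow> M P Q = power_mean 3 P Q"
    and st: "0 < s" "s \<le> t"
  shows "gauss_seq A M (scalar_mat s) (scalar_mat t) n
    = (scalar_mat (fst (scalar_gauss s t n)), scalar_mat (snd (scalar_gauss s t n)))"
proof (induction n)
  case 0
  then show ?case by simp
next
  case (Suc n)
  have "scalar_mat (fst (scalar_gauss s t n)) \<in> SPD2" "scalar_mat (snd (scalar_gauss s t n)) \<in> SPD2"
    using scalar_gauss_pos_le[OF st, of n] by (auto intro!: scalar_mat_in_SPD2)
  then show ?case
    unfolding gauss_seq.simps(2)[of A M] Suc scalar_gauss_Suc
    by (simp only: Let_def prod.case A M power_mean_scalar_mat fst_conv snd_conv)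
qed

lemma gauss_comp_eqI:
  assumes "is_gauss_limit A M P Q L"
  shows "gauss_comp A M P Q = L"
  unfolding gauss_comp_def
  using assms by (intro the_equality) (auto simp: is_gauss_limit_def intro: LIMSEQ_unique)

section \<open>Comparison of the means\<close>

theorem mainTheorem7:
  shows "(\<exists>DE DE' DLC. Phi_connections DE DE' DLC) \<and>
    (\<forall>DE DE' DLC A M M\<^sub>g.
       Phi_connections DE DE' DLC \<and>
       A = midpoint_mean DE \<and> M = midpoint_mean DE' \<and> M\<^sub>g = midpoint_mean DLC \<longrightarrow>
       (\<forall>p\<in>SPD2_dom. \<forall>u v.
          Hess Phi p u v
            = (p $ 1)\<^sup>2 * u $ 1 * v $ 1 + (p $ 2)\<^sup>2 * u $ 2 * v $ 2 + u $ 3 * v $ 3) \<and>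
       flat_with_affine_coordinates SPD2_dom DE' eta \<and>
       (\<forall>P\<in>SPD2. \<forall>Q\<in>SPD2.
          midpoint_mean_defined DE P Q \<and> A P Q = (1/2) *\<^sub>R (P + Q)) \<and>
       (\<forall>P\<in>SPD2. \<forall>Q\<in>SPD2. midpoint_mean_defined DLC P Q) \<and>
       convex (eta ` SPD2_dom) \<and>
       (\<forall>P\<in>SPD2. \<forall>Q\<in>SPD2.
          midpoint_mean_defined DE' P Q \<and>
          M P Q = sym_mat (the_inv_into SPD2_dom eta
                     ((1/2) *\<^sub>R (eta (coords P) + eta (coords Q))))) \<and>
       gauss_comp_exists A M (scalar_mat 1) (scalar_mat 2) \<and>
       gauss_comp A M (scalar_mat 1) (scalar_mat 2) \<noteq> M\<^sub>g (scalar_mat 1) (scalar_mat 2) \<and>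
       M\<^sub>g (scalar_mat 1) (scalar_mat 2) = scalar_mat (sqrt (5/2)) \<and>
       (\<forall>s t. s > 0 \<and> t > 0 \<and> s \<noteq> t \<longrightarrow>
          M\<^sub>g (A (scalar_mat s) (scalar_mat t)) (M (scalar_mat s) (scalar_mat t))
            \<noteq> M\<^sub>g (scalar_mat s) (scalar_mat t)))"
  (is "_ \<and> (\<forall>DE DE' DLC A M M\<^sub>g. ?hyp DE DE' DLC A M M\<^sub>g \<longrightarrow> ?concl DE DE' DLC A M M\<^sub>g)")
proof (intro conjI)
  show "\<exists>DE DE' DLC. Phi_connections DE DE' DLC"
    using Phi_connections_power_connection by blast
  show "\<forall>DE DE' DLC A M M\<^sub>g. ?hyp DE DE' DLC A M M\<^sub>g \<longrightarrow> ?concl DE DE' DLC A M M\<^sub>g"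
  proof (intro allI impI)
    fix DE DE' DLC A M M\<^sub>g
    assume hyp: "?hyp DE DE' DLC A M M\<^sub>g"
    then have conns: "Phi_connections DE DE' DLC" by blast
    note unique = Phi_connections_unique[OF conns]
    have spray: "has_power_spray 0 DE" "has_power_spray 2 DE'" "has_power_spray 1 DLC"
      by (simp_all add: has_power_spray_def unique smooth_on_const power_connection_const)
    have defined: "midpoint_mean_defined DE P Q" "midpoint_mean_defined DE' P Q"
      "midpoint_mean_defined DLC P Q" if "P \<in> SPD2" "Q \<in> SPD2" for P Q
      using spray[THEN midpoint_mean_power(1), OF that] by blast+
    have A: "A P Q = power_mean 1 P Q" and M: "M P Q = power_mean 3 P Q"
      and Mg: "M\<^sub>g P Q = power_mean 2 P Q" if "P \<in> SPD2" "Q \<in> SPD2" for P Q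
      using hyp spray[THEN midpoint_mean_power(2), OF that] by (simp_all add: eval_nat_numeral)
    have affine: "affine_connection SPD2_dom DE'"
      using conns by (simp add: Phi_connections_def dual_connection_def)
    have Mg_value: "M\<^sub>g (scalar_mat 1) (scalar_mat 2) = scalar_mat (sqrt (5/2))"
    proof -
      have "real_power_mean 2 1 2 = sqrt (5/2)" by (simp add: real_power_mean_def sqrt_def)
      then show ?thesis
        by (simp only: Mg scalar_mat_in_SPD2 power_mean_scalar_mat zero_less_one zero_less_numeral)
    qed
    obtain L where L: "(\<lambda>n. fst (scalar_gauss 1 2 n)) \<longlonglongrightarrow> L" "(\<lambda>n. snd (scalar_gauss 1 2 n)) \<longlonglongrightarrow> L"
      and pos: "0 < L" and less: "2 * L\<^sup>2 < 1\<^sup>2 + 2\<^sup>2"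
      using scalar_gauss_limit[of 1 2] by auto
    have limit: "is_gauss_limit A M (scalar_mat 1) (scalar_mat 2) (scalar_mat L)"
    proof -
      have "gauss_seq A M (scalar_mat 1) (scalar_mat 2) n
          = (scalar_mat (fst (scalar_gauss 1 2 n)), scalar_mat (snd (scalar_gauss 1 2 n)))" for n
        by (rule gauss_seq_scalar_mat[OF A M]) simp_all
      then show ?thesis
        unfolding is_gauss_limit_def
        by (simp only: fst_conv snd_conv)
          (intro conjI scalar_mat_in_SPD2 pos tendsto_scaleR tendsto_const L)
    qed
    \<comment> \<open>Twice the square of the Levi-Civita midpoint is exactly 1 + 4; twice that of the Gauss limit is less.\<close>
    have "L < sqrt (5/2)" using less by (intro real_less_rsqrt) simp
    then have "scalar_mat L \<noteq> scalar_mat (sqrt (5/2))" unfolding scalar_mat_inject by simp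
    then have gauss: "gauss_comp A M (scalar_mat 1) (scalar_mat 2) \<noteq> M\<^sub>g (scalar_mat 1) (scalar_mat 2)"
      by (simp only: gauss_comp_eqI[OF limit] Mg_value not_False_eq_True)
    have not_invariant: "M\<^sub>g (A (scalar_mat s) (scalar_mat t)) (M (scalar_mat s) (scalar_mat t))
        \<noteq> M\<^sub>g (scalar_mat s) (scalar_mat t)" if "s > 0" "t > 0" "s \<noteq> t" for s t
    proof -
      have "real_power_mean 2 (real_power_mean 1 s t) (real_power_mean 3 s t) < real_power_mean 2 s t"
        using mean_squares_less[OF that] unfolding real_power_mean_def[of 2] by simp
      then have "scalar_mat (real_power_mean 2 (real_power_mean 1 s t) (real_power_mean 3 s t))
          \<noteq> scalar_mat (real_power_mean 2 s t)"
        unfolding scalar_mat_inject by simp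
      then show ?thesis
        using that by (simp only: A M Mg scalar_mat_in_SPD2 real_power_mean_pos power_mean_scalar_mat
            zero_less_numeral zero_less_one not_False_eq_True)
    qed
    show "?concl DE DE' DLC A M M\<^sub>g"
    proof (intro conjI allI impI ballI)
      show "Hess Phi p u v = (p $ 1)\<^sup>2 * u $ 1 * v $ 1 + (p $ 2)\<^sup>2 * u $ 2 * v $ 2 + u $ 3 * v $ 3"
        for p u v by (rule Hess_Phi)
      show "flat_with_affine_coordinates SPD2_dom DE' eta"
        using affine unique(2) by (rule flat_eta)
      show "convex (eta ` SPD2_dom)" by (rule convex_eta_image)
      show "gauss_comp_exists A M (scalar_mat 1) (scalar_mat 2)"
        using limit unfolding gauss_comp_exists_def by blast
    qed (use defined A M power_mean_one power_mean_three gauss Mg_value not_invariant in auto)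
  qed
qed

end
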